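(* Let $m\le M$, $n\le N$ be positive integers, $1\le p,q\le\infty$, let $A=(a_{ij})_{i\le M,j\le N}$ be a real matrix, and let $G=(g_{ij})_{i\le M,j\le N}$ have i.i.d. standard Gaussian entries. Then $$\mathbb{E}\sup_{I_0,J_0}\|G_A\colon\ell_p^{J_0}\to\ell_q^{I_0}\| =\mathbb{E}\sup_{I_0,J_0}\sup_{x\in B_p^{J_0}}\sup_{y\in B_{q^*}^{I_0}}\sum_{i\in I_0}\sum_{j\in J_0}y_ia_{ij}g_{ij}x_j$$ $$\le \ln(en)^{1/p^*}\ln(em)^{1/q}\Big[\big(2.4\sqrt{\ln(mn)}+8\sqrt{\ln M}+\sqrt{2/\pi}\big)\sup_{I_0,J_0}\|A\circ A\colon\ell^{J_0}_{p/2}\to\ell^{I_0}_{q/2}\|^{1/2} +\big(8\sqrt{\ln N}+2\sqrt{2/\pi}\big)\sup_{I_0,J_0}\|(A\circ A)^T\colon\ell^{I_0}_{q^*/2}\to\ell^{J_0}_{p^*/2}\|^{1/2}\Big],$$ where the suprema are over all $I_0\subset\{1,\dots,M\}$, $J_0\subset\{1,\dots,N\}$ with $|I_0|=m$, $|J_0|=n$.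
   Context: For a nonempty $J\subset\{1,\dots,N\}$ and $0<s\le\infty$, $\ell_s^J$ is $\mathbb{R}^J$ with $\|x\|=(\sum_{j\in J}|x_j|^s)^{1/s}$ (max for $s=\infty$) and $B_s^J$ its unit ball. For a matrix $B$, $\|B\colon\ell_s^J\to\ell_t^I\|=\sup_{x\in B_s^J}\|((Bx)_i)_{i\in I}\|_{\ell_t^I}$, i.e. $B$ restricted to coordinates in $J$ and projected onto coordinates in $I$. $G_A=(a_{ij}g_{ij})$, $A\circ A=(a_{ij}^2)$, and $p^*$ is the Hölder conjugate of $p$ ($1/p+1/p^*=1$). *)

theory Defs
  imports "HOL-Probability.Probability"
begin

text \<open>Exponents s in (0, infinity] are represented as extended reals.
  lnorm s J x is the l_s^J (quasi-)norm of x restricted to the coordinates in J.\<close>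
definition lnorm :: "ereal \<Rightarrow> nat set \<Rightarrow> (nat \<Rightarrow> real) \<Rightarrow> real" where
  "lnorm s J x = (if s = \<infinity> then Max ((\<lambda>j. \<bar>x j\<bar>) ` J)
     else (\<Sum>j\<in>J. \<bar>x j\<bar> powr real_of_ereal s) powr (1 / real_of_ereal s))"

definition opnorm :: "(nat \<Rightarrow> nat \<Rightarrow> real) \<Rightarrow> ereal \<Rightarrow> ereal \<Rightarrow> nat set \<Rightarrow> nat set \<Rightarrow> real" where
  "opnorm B s t I J = Sup {lnorm t I (\<lambda>i. \<Sum>j\<in>J. B i j * x j) | x. lnorm s J x \<le> 1}"

definition hconj :: "ereal \<Rightarrow> ereal" where
  "hconj p = (if p = \<infinity> then 1 else if p = 1 then \<infinity> else p / (p - 1))"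

definition rexp :: "ereal \<Rightarrow> real" where
  "rexp s = (if s = \<infinity> then 0 else 1 / real_of_ereal s)"

definition subs :: "nat \<Rightarrow> nat \<Rightarrow> nat set set" where
  "subs K k = {S. S \<subseteq> {1..K} \<and> card S = k}"

definition gauss_mat :: "nat \<Rightarrow> nat \<Rightarrow> (nat \<times> nat \<Rightarrow> real) measure" where
  "gauss_mat M N = PiM ({1..M} \<times> {1..N}) (\<lambda>_. density lborel std_normal_density)"

end

theory Submission
  imports Defs "HOL-Real_Asymp.Real_Asymp"
begin

text \<open>The \<open>p*\<close>-norm of \<open>c \<in> \<real>\<^sup>n\<close> is at most \<open>ln (e n) powr (1 / p*)\<close> times the
  supremum of the functional \<open>c\<close> over the flat vectors \<open>|S| powr (- 1 / p) * \<epsilon>\<close> with \<open>\<epsilon>\<close> a sign vector on \<open>S\<close>.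
  Applied on both sides, this reduces the theorem to the Gaussian process
  \<open>\<Sum> a\<^sub>i\<^sub>j g\<^sub>i\<^sub>j x\<^sub>j y\<^sub>i\<close> over finitely many pairs of flat vectors. For fixed support sizes
  its increments are at most those of
  \<open>\<Sum> h\<^sub>i y\<^sub>i |(a\<^sub>i\<^sub>j x\<^sub>j)\<^sub>j|\<^sub>2 + \<Sum> h'\<^sub>j x\<^sub>j |(a\<^sub>i\<^sub>j y\<^sub>i)\<^sub>i|\<^sub>2\<close>, and one further independent
  Gaussian per pair of sizes separates different sizes, so the Sudakov--Fernique inequality
  applies. Hoelder's inequality bounds the supremum of the dominating process by the two norms of
  \<open>A \<circ> A\<close> times maxima of independent Gaussians.\<close>

section \<open>Standard Gaussian vectors\<close>

text \<open>Flatness is what makes the comparison work. If all coordinates lie in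
  \<open>{-c, 0, c}\<close>, coordinates of equal strict sign coincide. Hence a matrix entry
  contributes to an increment of the bilinear process only where \<open>y y' \<le> 0\<close> or
  \<open>x x' \<le> 0\<close>, and there the corresponding coordinate \<open>y L - y' L'\<close> of
  the dominating process, with row or column norms \<open>L\<close>, \<open>L'\<close>, has no
  cancellation. For general vectors such a difference can vanish although \<open>y x\<close> and
  \<open>y' x'\<close> differ. Flat vectors of different support sizes have different
  \<open>c\<close>, hence the extra Gaussians. The logarithmic factors come from harmonic numbers:
  if a functional is at most \<open>K\<close> on flat vectors, its \<open>l\<close>-th largest entry
  is at most \<open>K l powr (- 1 / s)\<close> with \<open>s = hconj p\<close>, and the
  \<open>s\<close>-th powers sum up to at most \<open>K powr s * harm n\<close> for finite
  \<open>s\<close>. The stated constants leave room: the argument yields 2 in place of 2.4, 2 in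
  place of 8 for sets with at least two elements, and one summand \<open>sqrt (2 / pi)\<close>
  instead of two.\<close>

definition gauss1 :: "real measure" where
  "gauss1 = density lborel std_normal_density"

definition gaussP :: "'k set \<Rightarrow> ('k \<Rightarrow> real) measure" where
  "gaussP K = PiM K (\<lambda>_. gauss1)"

lemma sets_gauss1 [measurable_cong, simp]: "sets gauss1 = sets borel"
  by (simp add: gauss1_def)

lemma space_gauss1 [simp]: "space gauss1 = UNIV"
  by (simp add: gauss1_def)

lemma prob_space_gauss1: "prob_space gauss1"
  unfolding gauss1_def by (rule prob_space_normal_density) simp

lemma prob_space_gaussP: "prob_space (gaussP K)"
  unfolding gaussP_def by (intro prob_space_PiM prob_space_gauss1)

lemma measurable_gaussP_component [measurable (raw)]:
  "k \<in> K \<Longrightarrow> (\<lambda>g. g k) \<in> borel_measurable (gaussP K)"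
  unfolding gaussP_def by measurable

lemma integral_gauss1:
  "f \<in> borel_measurable borel \<Longrightarrow>
    integral\<^sup>L gauss1 f = (\<integral>x. std_normal_density x * f x \<partial>lborel)" for f :: "real \<Rightarrow> real"
  using integral_density[of f lborel std_normal_density] by (simp add: gauss1_def)

lemma integrable_gauss1_iff:
  "f \<in> borel_measurable borel \<Longrightarrow>
    integrable gauss1 f \<longleftrightarrow> integrable lborel (\<lambda>x. std_normal_density x * f x)" for f :: "real \<Rightarrow> real"
  using integrable_density[of f lborel std_normal_density] by (simp add: gauss1_def)

section \<open>Moments of one standard Gaussian, coordinates of the product, integration by
  parts\<close>

lemma integrable_gauss1_id: "integrable gauss1 (\<lambda>x. x)"
  using integrable_std_normal_moment[of 1] by (simp add: integrable_gauss1_iff)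

lemma integral_gauss1_abs: "(\<integral>x. \<bar>x\<bar> \<partial>gauss1) = sqrt (2 / pi)"
  using integral_std_normal_moment_abs_odd[of 0] by (simp add: integral_gauss1)

text \<open>Completing the square turns the Gaussian density tilted by \<open>exp (c * x)\<close>
  into a multiple of the Gaussian density centred at \<open>c\<close>.\<close>

lemma gauss1_mgf:
  shows "integrable gauss1 (\<lambda>x. exp (c * x))" "(\<integral>x. exp (c * x) \<partial>gauss1) = exp (c\<^sup>2 / 2)"
proof -
  have eq: "std_normal_density x * exp (c * x) = exp (c\<^sup>2 / 2) * normal_density c 1 x" for x
  proof -
    have "- (x\<^sup>2) / 2 + c * x = c\<^sup>2 / 2 + - ((x - c)\<^sup>2) / 2"
      by (simp add: power2_diff add_divide_distrib diff_divide_distrib)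
    then have "exp (- (x\<^sup>2) / 2) * exp (c * x) = exp (c\<^sup>2 / 2) * exp (- ((x - c)\<^sup>2) / 2)"
      by (simp only: exp_add[symmetric])
    then show ?thesis
      by (simp add: normal_density_def)
  qed
  show "integrable gauss1 (\<lambda>x. exp (c * x))"
    by (subst integrable_gauss1_iff) (auto simp: eq)
  show "(\<integral>x. exp (c * x) \<partial>gauss1) = exp (c\<^sup>2 / 2)"
    by (subst integral_gauss1) (auto simp: eq)
qed

lemma distr_gaussP_component: "k \<in> K \<Longrightarrow> distr (gaussP K) gauss1 (\<lambda>g. g k) = gauss1"
  unfolding gaussP_def by (rule distr_PiM_component) (auto intro: prob_space_gauss1)

lemma gaussP_component:
  fixes f :: "real \<Rightarrow> real"
  assumes "k \<in> K" "f \<in> borel_measurable borel"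
  shows "integrable (gaussP K) (\<lambda>g. f (g k)) \<longleftrightarrow> integrable gauss1 f"
    and "(\<integral>g. f (g k) \<partial>gaussP K) = integral\<^sup>L gauss1 f"
proof -
  have m: "(\<lambda>g. g k) \<in> measurable (gaussP K) gauss1"
    using assms by measurable
  have f: "f \<in> borel_measurable gauss1"
    using assms by measurable
  show "integrable (gaussP K) (\<lambda>g. f (g k)) \<longleftrightarrow> integrable gauss1 f"
    using integrable_distr_eq[OF m f] by (simp add: distr_gaussP_component assms)
  show "(\<integral>g. f (g k) \<partial>gaussP K) = integral\<^sup>L gauss1 f"
    using integral_distr[OF m f] by (simp add: distr_gaussP_component assms)
qed

lemma integrable_gaussP_component [simp]: "k \<in> K \<Longrightarrow> integrable (gaussP K) (\<lambda>g. g k)"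
  by (subst gaussP_component(1)) (auto intro: integrable_gauss1_id)

text \<open>The Gaussian density satisfies \<open>\<phi>' x = - x * \<phi> x\<close>, so the
  difference of the two integrands is the derivative of \<open>\<phi> * f\<close>, which vanishes at
  both ends because \<open>f\<close> is bounded.\<close>

lemma gauss1_integration_by_parts:
  fixes f f' :: "real \<Rightarrow> real"
  assumes deriv: "\<And>x. (f has_real_derivative f' x) (at x)"
    and cont: "\<And>x. isCont f' x"
    and bf: "\<And>x. \<bar>f x\<bar> \<le> C" and bf': "\<And>x. \<bar>f' x\<bar> \<le> C"
  shows "(\<integral>x. x * f x \<partial>gauss1) = (\<integral>x. f' x \<partial>gauss1)"
proof -
  have contf: "isCont f x" for x
    using deriv by (rule DERIV_isCont)
  have mf [measurable]: "f \<in> borel_measurable borel"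
    using contf by (intro borel_measurable_continuous_onI continuous_at_imp_continuous_on) auto
  have mf' [measurable]: "f' \<in> borel_measurable borel"
    using cont by (intro borel_measurable_continuous_onI continuous_at_imp_continuous_on) auto
  let ?\<phi> = std_normal_density
  have d\<phi>: "(?\<phi> has_real_derivative - x * ?\<phi> x) (at x)" for x
    unfolding std_normal_density_def[abs_def]
    by (auto intro!: derivative_eq_intros simp: field_simps power2_eq_square)
  have i1: "integrable lborel (\<lambda>x. ?\<phi> x * (x * f x))"
  proof (rule Bochner_Integration.integrable_bound)
    show "integrable lborel (\<lambda>x. C * (?\<phi> x * \<bar>x\<bar> ^ 1))"
      by (intro integrable_mult_right integrable_std_normal_moment_abs)
    have "?\<phi> x * \<bar>x\<bar> * \<bar>f x\<bar> \<le> ?\<phi> x * \<bar>x\<bar> * C" for x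
      by (intro mult_left_mono bf) auto
    then show "AE x in lborel. norm (?\<phi> x * (x * f x)) \<le> norm (C * (?\<phi> x * \<bar>x\<bar> ^ 1))"
      using order_trans[OF abs_ge_zero bf[of 0]] by (auto simp: abs_mult ac_simps)
  qed auto
  have i2: "integrable lborel (\<lambda>x. ?\<phi> x * f' x)"
  proof (rule Bochner_Integration.integrable_bound)
    show "integrable lborel (\<lambda>x. C * (?\<phi> x * \<bar>x\<bar> ^ 0))"
      by (intro integrable_mult_right integrable_std_normal_moment_abs)
    have "?\<phi> x * \<bar>f' x\<bar> \<le> ?\<phi> x * C" for x
      by (intro mult_left_mono bf') auto
    then show "AE x in lborel. norm (?\<phi> x * f' x) \<le> norm (C * (?\<phi> x * \<bar>x\<bar> ^ 0))"
      using order_trans[OF abs_ge_zero bf[of 0]] by (auto simp: abs_mult ac_simps)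
  qed auto
  let ?h = "\<lambda>x. ?\<phi> x * f' x - ?\<phi> x * (x * f x)"
  have lim: "((\<lambda>x. ?\<phi> x * f x) \<longlongrightarrow> 0) F" if "(?\<phi> \<longlongrightarrow> 0) F" for F
  proof (rule Lim_null_comparison)
    show "\<forall>\<^sub>F x in F. norm (?\<phi> x * f x) \<le> ?\<phi> x * C"
      by (intro always_eventually allI) (auto simp: abs_mult intro!: mult_left_mono bf)
    show "((\<lambda>x. ?\<phi> x * C) \<longlongrightarrow> 0) F"
      using tendsto_mult_right[OF that, of C] by simp
  qed
  have l1: "(?\<phi> \<longlongrightarrow> 0) at_top" and l2: "(?\<phi> \<longlongrightarrow> 0) at_bot"
    unfolding std_normal_density_def[abs_def] by real_asymp+
  have "(LBINT x=-\<infinity>..\<infinity>. ?h x) = 0 - 0"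
  proof (rule interval_integral_FTC_integrable[where F = "\<lambda>x. ?\<phi> x * f x"])
    show "((\<lambda>x. ?\<phi> x * f x) has_vector_derivative ?h x) (at x)" for x
      unfolding has_real_derivative_iff_has_vector_derivative[symmetric]
      by (auto intro!: derivative_eq_intros d\<phi> deriv simp: algebra_simps)
    show "isCont ?h x" for x
      by (intro continuous_intros contf cont DERIV_isCont[OF d\<phi>])
    show "set_integrable lborel (einterval (-\<infinity>) \<infinity>) ?h"
      using i1 i2 by (simp add: set_integrable_def einterval_def)
    show "(((\<lambda>x. ?\<phi> x * f x) \<circ> real_of_ereal) \<longlongrightarrow> 0) (at_right (-\<infinity>))"
      "(((\<lambda>x. ?\<phi> x * f x) \<circ> real_of_ereal) \<longlongrightarrow> 0) (at_left \<infinity>)"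
      using lim[OF l1] lim[OF l2] by (simp_all add: ereal_tendsto_simps1)
  qed simp
  then have "(\<integral>x. ?h x \<partial>lborel) = 0"
    by (simp add: interval_lebesgue_integral_def set_lebesgue_integral_def einterval_def)
  then show ?thesis
    using i1 i2 by (simp add: integral_gauss1)
qed

lemma gaussP_integration_by_parts:
  fixes f f' :: "('k \<Rightarrow> real) \<Rightarrow> real"
  assumes K: "finite K" "k \<in> K"
    and [measurable]: "f \<in> borel_measurable (gaussP K)" "f' \<in> borel_measurable (gaussP K)"
    and deriv: "\<And>g x. ((\<lambda>x. f (g(k := x))) has_real_derivative f' (g(k := x))) (at x)"
    and cont: "\<And>g x. isCont (\<lambda>x. f' (g(k := x))) x"
    and bf: "\<And>g. \<bar>f g\<bar> \<le> C" and bf': "\<And>g. \<bar>f' g\<bar> \<le> C"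
  shows "integrable (gaussP K) (\<lambda>g. g k * f g)" "(\<integral>g. g k * f g \<partial>gaussP K) = (\<integral>g. f' g \<partial>gaussP K)"
proof -
  interpret prob_space "gaussP K"
    by (rule prob_space_gaussP)
  interpret product_sigma_finite "\<lambda>_::'k. gauss1"
    unfolding product_sigma_finite_def
    using prob_space_gauss1 prob_space_imp_sigma_finite by blast
  show 1: "integrable (gaussP K) (\<lambda>g. g k * f g)"
  proof (rule Bochner_Integration.integrable_bound)
    show "integrable (gaussP K) (\<lambda>g. C * g k)"
      using K by auto
    have "\<bar>g k\<bar> * \<bar>f g\<bar> \<le> \<bar>g k\<bar> * C" for g
      by (intro mult_left_mono bf) auto
    then show "AE g in gaussP K. norm (g k * f g) \<le> norm (C * g k)"
      using order_trans[OF abs_ge_zero bf[of undefined]] by (auto simp: abs_mult ac_simps)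
  qed (use K in measurable)
  have 2: "integrable (gaussP K) f'"
    by (rule integrable_const_bound[of _ C]) (auto intro: bf')
  \<comment> \<open>Writing \<open>K\<close> as an insertion lets Fubini split off the coordinate
    \<open>k\<close>; with the other coordinates frozen, the one-dimensional formula
    applies.\<close>
  have Keq: "gaussP K = PiM (insert k (K - {k})) (\<lambda>_. gauss1)"
    using K by (simp add: gaussP_def insert_absorb)
  have "(\<integral>g. g k * f g \<partial>gaussP K)
      = (\<integral>g. (\<integral>x. (g(k := x)) k * f (g(k := x)) \<partial>gauss1) \<partial>PiM (K - {k}) (\<lambda>_. gauss1))"
    unfolding Keq using K 1 by (intro product_integral_insert) (auto simp: Keq)
  also have "\<dots> = (\<integral>g. (\<integral>x. f' (g(k := x)) \<partial>gauss1) \<partial>PiM (K - {k}) (\<lambda>_. gauss1))"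
    using gauss1_integration_by_parts[OF deriv cont bf bf'] by simp
  also have "\<dots> = (\<integral>g. f' g \<partial>gaussP K)"
    unfolding Keq using K 2 by (intro product_integral_insert[symmetric]) (auto simp: Keq)
  finally show "(\<integral>g. g k * f g \<partial>gaussP K) = (\<integral>g. f' g \<partial>gaussP K)" .
qed

section \<open>The Sudakov--Fernique inequality\<close>

text \<open>These are the Gibbs weights of \<open>z\<close>. They form the gradient of log-sum-exp,
  which is how they enter the interpolation.\<close>

definition softmax :: "'t set \<Rightarrow> ('t \<Rightarrow> real) \<Rightarrow> 't \<Rightarrow> real" where
  "softmax T z t = exp (z t) / (\<Sum>s\<in>T. exp (z s))"

section \<open>Derivatives of softmax and log-sum-exp\<close>

lemma sum_exp_pos: "finite T \<Longrightarrow> T \<noteq> {} \<Longrightarrow> 0 < (\<Sum>s\<in>T. exp (z s :: real))"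
  by (intro sum_pos) auto

lemma softmax_nonneg: "0 \<le> softmax T z t"
  by (simp add: softmax_def sum_nonneg)

lemma softmax_le_1: "finite T \<Longrightarrow> t \<in> T \<Longrightarrow> softmax T z t \<le> 1"
  unfolding softmax_def
  by (rule divide_le_eq_1_pos[THEN iffD2]) (auto intro!: sum_exp_pos member_le_sum)

lemma sum_softmax: "finite T \<Longrightarrow> T \<noteq> {} \<Longrightarrow> (\<Sum>t\<in>T. softmax T z t) = 1"
  using sum_exp_pos[of T z] by (simp add: softmax_def flip: sum_divide_distrib)

lemma DERIV_softmax:
  assumes T: "finite T" "t \<in> T"
    and d: "\<And>s. s \<in> T \<Longrightarrow> ((\<lambda>x. z x s) has_real_derivative d s) (at x)"
  shows "((\<lambda>x. softmax T (z x) t) has_real_derivative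
      softmax T (z x) t * (d t - (\<Sum>s\<in>T. softmax T (z x) s * d s))) (at x)"
proof -
  have S: "(\<Sum>s\<in>T. exp (z x s)) \<noteq> 0"
    using sum_exp_pos[of T "z x"] T by (metis empty_iff less_irrefl)
  have "((\<lambda>x. softmax T (z x) t) has_real_derivative
      (exp (z x t) * d t * (\<Sum>s\<in>T. exp (z x s)) - exp (z x t) * (\<Sum>s\<in>T. exp (z x s) * d s))
        / ((\<Sum>s\<in>T. exp (z x s)) * (\<Sum>s\<in>T. exp (z x s)))) (at x)"
    unfolding softmax_def
    by (intro DERIV_divide DERIV_sum DERIV_chain2[OF DERIV_exp] d T S)
  also have "(exp (z x t) * d t * (\<Sum>s\<in>T. exp (z x s)) - exp (z x t) * (\<Sum>s\<in>T. exp (z x s) * d s))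
        / ((\<Sum>s\<in>T. exp (z x s)) * (\<Sum>s\<in>T. exp (z x s)))
      = softmax T (z x) t * (d t - (\<Sum>s\<in>T. softmax T (z x) s * d s))"
    using S by (simp add: softmax_def sum_divide_distrib[symmetric] divide_simps)
      (simp add: algebra_simps)
  finally show ?thesis .
qed

lemma DERIV_ln_sum_exp:
  assumes T: "finite T" "T \<noteq> {}"
    and d: "\<And>s. s \<in> T \<Longrightarrow> ((\<lambda>x. z x s) has_real_derivative d s) (at x)"
  shows "((\<lambda>x. ln (\<Sum>s\<in>T. exp (z x s))) has_real_derivative (\<Sum>s\<in>T. softmax T (z x) s * d s)) (at x)"
proof -
  have "((\<lambda>x. ln (\<Sum>s\<in>T. exp (z x s))) has_real_derivative
      inverse (\<Sum>s\<in>T. exp (z x s)) * (\<Sum>s\<in>T. exp (z x s) * d s)) (at x)"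
    by (intro DERIV_chain2[OF DERIV_ln] DERIV_sum DERIV_chain2[OF DERIV_exp] d sum_exp_pos T)
  also have "inverse (\<Sum>s\<in>T. exp (z x s)) * (\<Sum>s\<in>T. exp (z x s) * d s)
      = (\<Sum>s\<in>T. softmax T (z x) s * d s)"
    by (simp add: softmax_def sum_distrib_left field_simps)
  finally show ?thesis .
qed

text \<open>Both sides are the covariance of \<open>a\<close> and \<open>b\<close> under the weights
  \<open>p\<close>; the right side expresses it through two independent samples. Only differences
  occur there, which is why a comparison of increments is enough.\<close>

lemma weighted_covariance:
  fixes p :: "'t \<Rightarrow> real"
  assumes "sum p T = 1"
  shows "(\<Sum>t\<in>T. b t * (p t * (a t - (\<Sum>s\<in>T. p s * a s))))
    = (\<Sum>t\<in>T. \<Sum>s\<in>T. p t * p s * ((b t - b s) * (a t - a s))) / 2"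
proof -
  define m where "m = (\<Sum>s\<in>T. p s * a s)"
  have "(\<Sum>t\<in>T. \<Sum>s\<in>T. p t * p s * ((b t - b s) * (a t - a s)))
      = (\<Sum>t\<in>T. \<Sum>s\<in>T. (p t * b t * a t) * p s - (p t * b t) * (p s * a s)
          - (p t * a t) * (p s * b s) + p t * (p s * b s * a s))"
    by (simp add: algebra_simps)
  also have "\<dots> = 2 * ((\<Sum>t\<in>T. p t * b t * a t) - (\<Sum>t\<in>T. p t * b t) * (\<Sum>s\<in>T. p s * a s))"
    by (simp add: sum.distrib sum_subtractf assms flip: sum_distrib_left sum_distrib_right)
  also have "(\<Sum>t\<in>T. p t * b t * a t) - (\<Sum>t\<in>T. p t * b t) * (\<Sum>s\<in>T. p s * a s)
      = (\<Sum>t\<in>T. b t * (p t * (a t - (\<Sum>s\<in>T. p s * a s))))"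
    unfolding m_def[symmetric] by (simp add: sum_distrib_left sum_distrib_right sum_subtractf algebra_simps)
  finally show ?thesis by simp
qed

lemma integrable_gaussP_linear:
  "integrable (gaussP K) (\<lambda>g. \<Sum>k\<in>K. w k * g k)"
  by (intro Bochner_Integration.integrable_sum integrable_mult_right integrable_gaussP_component)

text \<open>The integral is the derivative of the expected log-sum-exp when the coefficients
  \<open>w\<close> move with velocity \<open>w'\<close>. Integration by parts trades each factor
  \<open>g k\<close> for a partial derivative of a softmax weight, and
  \<open>weighted_covariance\<close> turns the result into a nonnegative combination of the sums in
  \<open>mono\<close>. Each of these is half the derivative of a squared increment.\<close>

lemma gaussP_softmax_drift_nonneg:
  fixes w w' :: "'t \<Rightarrow> 'k \<Rightarrow> real"
  assumes T: "finite T" "T \<noteq> {}" and K: "finite K"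
    and mono: "\<And>s t. s \<in> T \<Longrightarrow> t \<in> T \<Longrightarrow> 0 \<le> (\<Sum>k\<in>K. (w' s k - w' t k) * (w s k - w t k))"
  shows "0 \<le> (\<integral>g. (\<Sum>t\<in>T. softmax T (\<lambda>s. \<Sum>k\<in>K. w s k * g k) t * (\<Sum>k\<in>K. w' t k * g k)) \<partial>gaussP K)"
proof -
  interpret prob_space "gaussP K"
    by (rule prob_space_gaussP)
  define p where "p g t = softmax T (\<lambda>s. \<Sum>k\<in>K. w s k * g k) t" for g t
  define p' where "p' k g t = p g t * (w t k - (\<Sum>s\<in>T. p g s * w s k))" for k g t
  \<comment> \<open>One constant has to bound both the weights and all their partial derivatives;
    the summand 1 takes care of the weights.\<close>
  define C where "C = 1 + (\<Sum>k\<in>K. 2 * (\<Sum>s\<in>T. \<bar>w s k\<bar>))"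
  have p_nn: "0 \<le> p g t" for g t
    by (simp add: p_def softmax_nonneg)
  have p_le: "p g t \<le> 1" if "t \<in> T" for g t
    using that T by (simp add: p_def softmax_le_1)
  have p_sum: "(\<Sum>t\<in>T. p g t) = 1" for g
    using T by (simp add: p_def sum_softmax)
  have C1: "1 \<le> C"
    by (simp add: C_def sum_nonneg)
  have bp: "\<bar>p g t\<bar> \<le> C" if "t \<in> T" for g t
    using p_nn p_le[OF that] C1 by (auto intro: order_trans)
  have bp': "\<bar>p' k g t\<bar> \<le> C" if "t \<in> T" "k \<in> K" for k g t
  proof -
    have "\<bar>\<Sum>s\<in>T. p g s * w s k\<bar> \<le> (\<Sum>s\<in>T. \<bar>w s k\<bar>)"
      using p_nn p_le by (intro order_trans[OF sum_abs] sum_mono)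
        (auto simp: abs_mult intro: mult_left_le_one_le)
    moreover have "\<bar>w t k\<bar> \<le> (\<Sum>s\<in>T. \<bar>w s k\<bar>)"
      using T that by (intro member_le_sum) auto
    ultimately have "\<bar>w t k - (\<Sum>s\<in>T. p g s * w s k)\<bar> \<le> 2 * (\<Sum>s\<in>T. \<bar>w s k\<bar>)"
      by linarith
    also have "\<dots> \<le> (\<Sum>k\<in>K. 2 * (\<Sum>s\<in>T. \<bar>w s k\<bar>))"
      using K that by (intro member_le_sum[of k]) (auto intro: sum_nonneg)
    finally have "\<bar>w t k - (\<Sum>s\<in>T. p g s * w s k)\<bar> \<le> C"
      by (simp add: C_def)
    then have "\<bar>p g t\<bar> * \<bar>w t k - (\<Sum>s\<in>T. p g s * w s k)\<bar> \<le> 1 * C"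
      using p_nn p_le[OF that(1)] by (intro mult_mono) auto
    then show ?thesis
      by (simp add: p'_def abs_mult)
  qed
  have m: "(\<lambda>g. p g t) \<in> borel_measurable (gaussP K)" for t
    unfolding p_def softmax_def by measurable
  have m': "(\<lambda>g. p' k g t) \<in> borel_measurable (gaussP K)" for k t
    unfolding p'_def using m by measurable
  have lin: "((\<lambda>x. \<Sum>k\<in>K. w s k * (g(k0 := x)) k) has_real_derivative w s k0) (at x)"
    if "k0 \<in> K" for s g k0 x
  proof -
    have "(\<Sum>k\<in>K. w s k * (g(k0 := x)) k) = w s k0 * x + (\<Sum>k\<in>K - {k0}. w s k * g k)" for x
      using K that by (subst sum.remove[of K k0]) (auto intro: sum.cong)
    then show ?thesis
      by (auto intro!: derivative_eq_intros)
  qed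
  have dp: "((\<lambda>x. p (g(k := x)) t) has_real_derivative p' k (g(k := x)) t) (at x)"
    if "t \<in> T" "k \<in> K" for g k t x
    unfolding p'_def p_def using that T by (intro DERIV_softmax lin) auto
  have cp': "isCont (\<lambda>x. p' k (g(k := x)) t) x" if "t \<in> T" "k \<in> K" for g k t x
    unfolding p'_def using that by (intro continuous_intros DERIV_isCont[OF dp])
  have ibp: "integrable (gaussP K) (\<lambda>g. g k * p g t)"
    "(\<integral>g. g k * p g t \<partial>gaussP K) = (\<integral>g. p' k g t \<partial>gaussP K)" if "t \<in> T" "k \<in> K" for k t
    using gaussP_integration_by_parts[OF K that(2) m m' dp[OF that] cp'[OF that] bp[OF that(1)] bp'[OF that]]
    by auto
  have ip': "integrable (gaussP K) (\<lambda>g. p' k g t)" if "t \<in> T" "k \<in> K" for k t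
    by (rule integrable_const_bound[of _ C]) (auto intro: bp' that m')
  have "0 \<le> (\<integral>g. (\<Sum>t\<in>T. \<Sum>k\<in>K. w' t k * p' k g t) \<partial>gaussP K)"
  proof (intro integral_nonneg_AE AE_I2)
    fix g
    have "(\<Sum>t\<in>T. \<Sum>k\<in>K. w' t k * p' k g t)
        = (\<Sum>k\<in>K. \<Sum>t\<in>T. w' t k * (p g t * (w t k - (\<Sum>s\<in>T. p g s * w s k))))"
      by (subst sum.swap) (simp add: p'_def)
    also have "\<dots> = (\<Sum>k\<in>K. \<Sum>t\<in>T. \<Sum>s\<in>T. p g t * p g s * ((w' t k - w' s k) * (w t k - w s k))) / 2"
      by (simp add: weighted_covariance[OF p_sum] sum_divide_distrib)
    also have "(\<Sum>k\<in>K. \<Sum>t\<in>T. \<Sum>s\<in>T. p g t * p g s * ((w' t k - w' s k) * (w t k - w s k)))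
        = (\<Sum>t\<in>T. \<Sum>s\<in>T. p g t * p g s * (\<Sum>k\<in>K. (w' t k - w' s k) * (w t k - w s k)))"
      by (subst sum.swap, rule sum.cong[OF refl], subst sum.swap) (simp add: sum_distrib_left)
    finally have "(\<Sum>t\<in>T. \<Sum>k\<in>K. w' t k * p' k g t)
        = (\<Sum>t\<in>T. \<Sum>s\<in>T. p g t * p g s * (\<Sum>k\<in>K. (w' t k - w' s k) * (w t k - w s k))) / 2" .
    also have "0 \<le> \<dots>"
      by (intro divide_nonneg_nonneg sum_nonneg mult_nonneg_nonneg p_nn mono) auto
    finally show "0 \<le> (\<Sum>t\<in>T. \<Sum>k\<in>K. w' t k * p' k g t)" .
  qed
  also have "\<dots> = (\<Sum>t\<in>T. \<Sum>k\<in>K. w' t k * (\<integral>g. p' k g t \<partial>gaussP K))"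
    using ip' by (simp add: Bochner_Integration.integral_sum)
  also have "\<dots> = (\<Sum>t\<in>T. \<Sum>k\<in>K. w' t k * (\<integral>g. g k * p g t \<partial>gaussP K))"
    using ibp(2) by simp
  also have "\<dots> = (\<integral>g. (\<Sum>t\<in>T. \<Sum>k\<in>K. w' t k * (g k * p g t)) \<partial>gaussP K)"
    using ibp(1) by (simp add: Bochner_Integration.integral_sum)
  also have "\<dots> = (\<integral>g. (\<Sum>t\<in>T. p g t * (\<Sum>k\<in>K. w' t k * g k)) \<partial>gaussP K)"
    by (simp add: sum_distrib_left ac_simps)
  finally show ?thesis
    by (simp add: p_def)
qed

section \<open>Log-sum-exp as a smooth maximum, and its Gaussian comparison\<close>

lemma abs_ln_sum_exp_le:
  assumes T: "finite T" "T \<noteq> {}"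
  shows "\<bar>ln (\<Sum>t\<in>T. exp (z t :: real))\<bar> \<le> ln (card T) + (\<Sum>t\<in>T. \<bar>z t\<bar>)"
proof -
  have c: "1 \<le> real (card T)"
    using T by (simp add: Suc_le_eq card_gt_0_iff)
  obtain t where t: "t \<in> T"
    using T by auto
  have z: "\<bar>z s\<bar> \<le> (\<Sum>t\<in>T. \<bar>z t\<bar>)" if "s \<in> T" for s
    using T that by (intro member_le_sum) auto
  have "(\<Sum>t\<in>T. exp (z t)) \<le> (\<Sum>t\<in>T. exp (\<Sum>t\<in>T. \<bar>z t\<bar>))"
    using z by (intro sum_mono) (force simp: abs_le_iff)
  also have "\<dots> = card T * exp (\<Sum>t\<in>T. \<bar>z t\<bar>)"
    by simp
  finally have "ln (\<Sum>t\<in>T. exp (z t)) \<le> ln (card T * exp (\<Sum>t\<in>T. \<bar>z t\<bar>))"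
    using sum_exp_pos[OF T, of z] by simp
  also have "\<dots> = ln (card T) + (\<Sum>t\<in>T. \<bar>z t\<bar>)"
    using c by (subst ln_mult) auto
  finally have 1: "ln (\<Sum>t\<in>T. exp (z t)) \<le> ln (card T) + (\<Sum>t\<in>T. \<bar>z t\<bar>)" .
  have "exp (z t) \<le> (\<Sum>t\<in>T. exp (z t))"
    using T t by (intro member_le_sum) auto
  then have "z t \<le> ln (\<Sum>t\<in>T. exp (z t))"
    using sum_exp_pos[OF T, of z] by (simp add: ln_ge_iff)
  then have "- (\<Sum>t\<in>T. \<bar>z t\<bar>) \<le> ln (\<Sum>t\<in>T. exp (z t))"
    using z[OF t] by linarith
  then show ?thesis
    using 1 ln_ge_zero[OF c] by linarith
qed

lemma integrable_ln_sum_exp: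
  fixes w :: "'t \<Rightarrow> 'k \<Rightarrow> real"
  assumes T: "finite T" "T \<noteq> {}"
  shows "integrable (gaussP K) (\<lambda>g. ln (\<Sum>t\<in>T. exp (\<Sum>k\<in>K. w t k * g k)))"
proof (rule Bochner_Integration.integrable_bound)
  interpret prob_space "gaussP K"
    by (rule prob_space_gaussP)
  show "integrable (gaussP K) (\<lambda>g. ln (card T) + (\<Sum>t\<in>T. \<bar>\<Sum>k\<in>K. w t k * g k\<bar>))"
    by (intro Bochner_Integration.integrable_add Bochner_Integration.integrable_sum integrable_abs
        integrable_gaussP_linear integrable_const)
  show "(\<lambda>g. ln (\<Sum>t\<in>T. exp (\<Sum>k\<in>K. w t k * g k))) \<in> borel_measurable (gaussP K)"
    by measurable
  show "AE g in gaussP K. norm (ln (\<Sum>t\<in>T. exp (\<Sum>k\<in>K. w t k * g k)))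
      \<le> norm (ln (card T) + (\<Sum>t\<in>T. \<bar>\<Sum>k\<in>K. w t k * g k\<bar>))"
    unfolding real_norm_def
    by (intro AE_I2 order_trans[OF abs_ln_sum_exp_le[OF T] abs_ge_self])
qed

text \<open>The interpolation \<open>w \<theta> = cos \<theta> u + sin \<theta> v\<close> leads from \<open>u\<close> to \<open>v\<close>; since
  the two families are orthogonal, its squared increments are nondecreasing in \<open>\<theta>\<close>.\<close>

lemma ln_sum_exp_gaussian_comparison:
  fixes u v :: "'t \<Rightarrow> 'k \<Rightarrow> real"
  assumes T: "finite T" "T \<noteq> {}" and K: "finite K"
    and orth: "\<And>s t. s \<in> T \<Longrightarrow> t \<in> T \<Longrightarrow> (\<Sum>k\<in>K. u s k * v t k) = 0"
    and incr: "\<And>s t. s \<in> T \<Longrightarrow> t \<in> T \<Longrightarrow>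
      (\<Sum>k\<in>K. (u s k - u t k)\<^sup>2) \<le> (\<Sum>k\<in>K. (v s k - v t k)\<^sup>2)"
  shows "(\<integral>g. ln (\<Sum>t\<in>T. exp (\<Sum>k\<in>K. u t k * g k)) \<partial>gaussP K)
       \<le> (\<integral>g. ln (\<Sum>t\<in>T. exp (\<Sum>k\<in>K. v t k * g k)) \<partial>gaussP K)"
proof -
  interpret prob_space "gaussP K"
    by (rule prob_space_gaussP)
  interpret pair_sigma_finite "gaussP K" lborel ..
  define w where "w \<theta> t k = cos \<theta> * u t k + sin \<theta> * v t k" for \<theta> t k
  define w' where "w' \<theta> t k = - sin \<theta> * u t k + cos \<theta> * v t k" for \<theta> t k
  define F where "F \<theta> g = ln (\<Sum>t\<in>T. exp (\<Sum>k\<in>K. w \<theta> t k * g k))" for \<theta> g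
  define F' where "F' \<theta> g =
    (\<Sum>t\<in>T. softmax T (\<lambda>s. \<Sum>k\<in>K. w \<theta> s k * g k) t * (\<Sum>k\<in>K. w' \<theta> t k * g k))" for \<theta> g
  \<comment> \<open>The cutoff makes the \<theta>-integral one over the whole line, so that Fubini
    on \<open>gaussP K\<close> and \<open>lborel\<close> can exchange it with the
    expectation.\<close>
  define H where "H g \<theta> = F' \<theta> g * indicator {0..pi/2} \<theta>" for g \<theta>
  have dw: "((\<lambda>\<theta>. \<Sum>k\<in>K. w \<theta> t k * g k) has_real_derivative (\<Sum>k\<in>K. w' \<theta> t k * g k)) (at \<theta>)"
    for \<theta> t g
    unfolding w_def w'_def by (auto intro!: derivative_eq_intros sum.cong)
  have dF: "((\<lambda>\<theta>. F \<theta> g) has_real_derivative F' \<theta> g) (at \<theta>)" for \<theta> g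
    unfolding F_def F'_def by (intro DERIV_ln_sum_exp T dw)
  have cF': "isCont (\<lambda>\<theta>. F' \<theta> g) \<theta>" for \<theta> g
    unfolding F'_def softmax_def w_def w'_def using sum_exp_pos[OF T]
    by (intro continuous_intros) (auto simp: less_imp_neq[symmetric])
  have ftc: "has_bochner_integral lborel (H g) (F (pi/2) g - F 0 g)" for g
    unfolding H_def by (rule has_bochner_integral_FTC_Icc_real) (auto intro: dF cF')
  have bF': "\<bar>F' \<theta> g\<bar> \<le> (\<Sum>t\<in>T. \<Sum>k\<in>K. (\<bar>u t k\<bar> + \<bar>v t k\<bar>) * \<bar>g k\<bar>)" for \<theta> g
  proof -
    have w': "\<bar>w' \<theta> t k\<bar> \<le> \<bar>u t k\<bar> + \<bar>v t k\<bar>" for t k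
    proof -
      have "\<bar>w' \<theta> t k\<bar> \<le> \<bar>sin \<theta>\<bar> * \<bar>u t k\<bar> + \<bar>cos \<theta>\<bar> * \<bar>v t k\<bar>"
        unfolding w'_def by (rule order_trans[OF abs_triangle_ineq]) (simp add: abs_mult)
      also have "\<dots> \<le> 1 * \<bar>u t k\<bar> + 1 * \<bar>v t k\<bar>"
        by (intro add_mono mult_right_mono) auto
      finally show ?thesis by simp
    qed
    have "\<bar>F' \<theta> g\<bar> \<le> (\<Sum>t\<in>T. 1 * \<bar>\<Sum>k\<in>K. w' \<theta> t k * g k\<bar>)"
      unfolding F'_def using T
      by (intro order_trans[OF sum_abs] sum_mono)
        (auto simp: abs_mult softmax_nonneg intro!: mult_left_le_one_le softmax_le_1)
    also have "\<dots> \<le> (\<Sum>t\<in>T. \<Sum>k\<in>K. (\<bar>u t k\<bar> + \<bar>v t k\<bar>) * \<bar>g k\<bar>)"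
      unfolding mult_1
      by (intro sum_mono order_trans[OF sum_abs]) (auto simp: abs_mult intro!: mult_right_mono w')
    finally show ?thesis .
  qed
  have mH: "case_prod H \<in> borel_measurable (gaussP K \<Otimes>\<^sub>M lborel)"
  proof -
    have [measurable]: "(\<lambda>p. fst p k) \<in> borel_measurable (gaussP K \<Otimes>\<^sub>M lborel)" if "k \<in> K" for k
      by (rule measurable_compose[OF measurable_fst measurable_gaussP_component[OF that]])
    show ?thesis
      unfolding H_def F'_def softmax_def w_def w'_def case_prod_beta by measurable
  qed
  have iH: "integrable (gaussP K \<Otimes>\<^sub>M lborel) (case_prod H)"
  proof (rule Fubini_integrable[OF mH])
    show "AE g in gaussP K. integrable lborel (\<lambda>\<theta>. case (g, \<theta>) of (g, \<theta>) \<Rightarrow> H g \<theta>)"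
      using ftc by (auto intro!: AE_I2 simp: has_bochner_integral_iff)
    let ?b = "\<lambda>g. (\<Sum>t\<in>T. \<Sum>k\<in>K. (\<bar>u t k\<bar> + \<bar>v t k\<bar>) * \<bar>g k\<bar>)"
    show "integrable (gaussP K) (\<lambda>g. \<integral>\<theta>. norm (case (g, \<theta>) of (g, \<theta>) \<Rightarrow> H g \<theta>) \<partial>lborel)"
    proof (rule Bochner_Integration.integrable_bound)
      show "integrable (gaussP K) (\<lambda>g. ?b g * (pi/2))"
        by (intro integrable_mult_left Bochner_Integration.integrable_sum integrable_mult_right
            integrable_abs integrable_gaussP_component)
      show "(\<lambda>g. \<integral>\<theta>. norm (case (g, \<theta>) of (g, \<theta>) \<Rightarrow> H g \<theta>) \<partial>lborel) \<in> borel_measurable (gaussP K)"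
        using measurable_compose[OF mH borel_measurable_norm]
        by (simp only: prod.case) (intro lborel.borel_measurable_lebesgue_integral, simp add: case_prod_beta')
      show "AE g in gaussP K. norm (\<integral>\<theta>. norm (case (g, \<theta>) of (g, \<theta>) \<Rightarrow> H g \<theta>) \<partial>lborel)
          \<le> norm (?b g * (pi/2))"
      proof (rule AE_I2)
        fix g
        have b0: "0 \<le> ?b g"
          by (intro sum_nonneg mult_nonneg_nonneg) auto
        have "(\<integral>\<theta>. norm (H g \<theta>) \<partial>lborel) \<le> (\<integral>\<theta>. ?b g * indicator {0..pi/2} \<theta> \<partial>lborel)"
        proof (rule integral_mono)
          show "integrable lborel (\<lambda>\<theta>. norm (H g \<theta>))"
            using ftc by (auto simp: has_bochner_integral_iff)
          show "integrable lborel (\<lambda>\<theta>. ?b g * indicator {0..pi/2} \<theta> :: real)"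
            by (intro integrable_mult_right integrable_real_indicator) auto
          show "norm (H g \<theta>) \<le> ?b g * indicator {0..pi/2} \<theta>" for \<theta>
            unfolding H_def using bF'[of \<theta> g] b0
            by (auto simp: indicator_def)
        qed
        also have "\<dots> = ?b g * (pi/2)"
          by simp
        finally show "norm (\<integral>\<theta>. norm (case (g, \<theta>) of (g, \<theta>) \<Rightarrow> H g \<theta>) \<partial>lborel)
            \<le> norm (?b g * (pi/2))"
          using b0 by (simp add: abs_mult integral_nonneg_AE)
      qed
    qed
  qed
  have pos: "0 \<le> (\<integral>g. F' \<theta> g \<partial>gaussP K)" if "0 \<le> \<theta>" "\<theta> \<le> pi/2" for \<theta>
    unfolding F'_def
  proof (rule gaussP_softmax_drift_nonneg[OF T K])
    fix s t assume st: "s \<in> T" "t \<in> T"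
    have cs: "0 \<le> sin \<theta> * cos \<theta>"
      using that by (intro mult_nonneg_nonneg sin_ge_zero cos_ge_zero) auto
    \<comment> \<open>The mixed products of \<open>u\<close> and \<open>v\<close> all carry the
      factor \<open>(cos \<theta>)\<^sup>2 - (sin \<theta>)\<^sup>2\<close> and sum to 0 by
      \<open>orth\<close>.\<close>
    have "(\<Sum>k\<in>K. (w' \<theta> s k - w' \<theta> t k) * (w \<theta> s k - w \<theta> t k))
        = (\<Sum>k\<in>K. sin \<theta> * cos \<theta> * (v s k - v t k)\<^sup>2 - sin \<theta> * cos \<theta> * (u s k - u t k)\<^sup>2
          + ((cos \<theta>)\<^sup>2 - (sin \<theta>)\<^sup>2) * (u s k * v s k - u s k * v t k - u t k * v s k + u t k * v t k))"
      unfolding w_def w'_def by (intro sum.cong refl) (simp add: power2_eq_square algebra_simps)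
    also have "\<dots> = sin \<theta> * cos \<theta> * ((\<Sum>k\<in>K. (v s k - v t k)\<^sup>2) - (\<Sum>k\<in>K. (u s k - u t k)\<^sup>2))"
      using orth st
      by (simp add: sum.distrib sum_subtractf right_diff_distrib flip: sum_distrib_left)
    also have "\<dots> \<ge> 0"
      using incr[OF st] by (intro mult_nonneg_nonneg[OF cs]) simp
    finally show "0 \<le> (\<Sum>k\<in>K. (w' \<theta> s k - w' \<theta> t k) * (w \<theta> s k - w \<theta> t k))" .
  qed
  have iF: "integrable (gaussP K) (F \<theta>)" for \<theta>
    unfolding F_def by (rule integrable_ln_sum_exp[OF T])
  have "0 \<le> (\<integral>\<theta>. (\<integral>g. H g \<theta> \<partial>gaussP K) \<partial>lborel)"
  proof (rule integral_nonneg_AE, rule AE_I2)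
    fix \<theta> :: real
    show "0 \<le> (\<integral>g. H g \<theta> \<partial>gaussP K)"
      using pos[of \<theta>] by (simp add: H_def indicator_def)
  qed
  also have "\<dots> = (\<integral>g. (\<integral>\<theta>. H g \<theta> \<partial>lborel) \<partial>gaussP K)"
    by (rule Fubini_integral[OF iH])
  also have "\<dots> = (\<integral>g. F (pi/2) g - F 0 g \<partial>gaussP K)"
    using ftc by (simp add: has_bochner_integral_iff)
  also have "\<dots> = (\<integral>g. F (pi/2) g \<partial>gaussP K) - (\<integral>g. F 0 g \<partial>gaussP K)"
    by (intro Bochner_Integration.integral_diff iF)
  finally show ?thesis
    by (simp add: F_def w_def)
qed

lemma ln_sum_exp_bounds:
  fixes z :: "'t \<Rightarrow> real"
  assumes T: "finite T" "T \<noteq> {}" and b: "0 < b"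
  shows "b * Max (z ` T) \<le> ln (\<Sum>t\<in>T. exp (b * z t))"
    and "ln (\<Sum>t\<in>T. exp (b * z t)) \<le> b * Max (z ` T) + ln (card T)"
proof -
  have c: "0 < real (card T)"
    using T by (simp add: card_gt_0_iff)
  have S: "0 < (\<Sum>t\<in>T. exp (b * z t))"
    using sum_exp_pos[OF T, of "\<lambda>t. b * z t"] .
  have "Max (z ` T) \<in> z ` T"
    using T by (intro Max_in) auto
  then obtain t where t: "t \<in> T" "Max (z ` T) = z t"
    by auto
  have "exp (b * z t) \<le> (\<Sum>t\<in>T. exp (b * z t))"
    using T t by (intro member_le_sum) auto
  then show "b * Max (z ` T) \<le> ln (\<Sum>t\<in>T. exp (b * z t))"
    using S t by (simp add: ln_ge_iff)
  have "(\<Sum>t\<in>T. exp (b * z t)) \<le> (\<Sum>s\<in>T. exp (b * Max (z ` T)))"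
    using T b by (intro sum_mono) auto
  then have "ln (\<Sum>t\<in>T. exp (b * z t)) \<le> ln (card T * exp (b * Max (z ` T)))"
    using S by simp
  also have "\<dots> = b * Max (z ` T) + ln (card T)"
    using c by (subst ln_mult) auto
  finally show "ln (\<Sum>t\<in>T. exp (b * z t)) \<le> b * Max (z ` T) + ln (card T)" .
qed

lemma integrable_Max:
  fixes f :: "'t \<Rightarrow> 'a \<Rightarrow> real"
  assumes T: "finite T" "T \<noteq> {}" and f: "\<And>t. t \<in> T \<Longrightarrow> integrable M (f t)"
  shows "integrable M (\<lambda>x. Max ((\<lambda>t. f t x) ` T))"
  using T f
proof (induction T rule: finite_ne_induct)
  case (insert t T)
  then have "(\<lambda>x. Max ((\<lambda>t. f t x) ` insert t T)) = (\<lambda>x. max (f t x) (Max ((\<lambda>t. f t x) ` T)))"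
    by auto
  then show ?case
    using insert by (auto intro!: integrable_max)
qed auto

text \<open>Divided by \<open>b\<close>, the log-sum-exp of \<open>b * z\<close> exceeds the maximum
  by at most \<open>ln (card T) / b\<close>, so the comparison passes to the maximum for large
  \<open>b\<close>. By \<open>orth\<close> the two families are uncorrelated: one Gaussian vector
  carries independent copies of both processes.\<close>

lemma sudakov_fernique:
  fixes u v :: "'t \<Rightarrow> 'k \<Rightarrow> real"
  assumes T: "finite T" "T \<noteq> {}" and K: "finite K"
    and orth: "\<And>s t. s \<in> T \<Longrightarrow> t \<in> T \<Longrightarrow> (\<Sum>k\<in>K. u s k * v t k) = 0"
    and incr: "\<And>s t. s \<in> T \<Longrightarrow> t \<in> T \<Longrightarrow>
      (\<Sum>k\<in>K. (u s k - u t k)\<^sup>2) \<le> (\<Sum>k\<in>K. (v s k - v t k)\<^sup>2)"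
  shows "(\<integral>g. Max ((\<lambda>t. \<Sum>k\<in>K. u t k * g k) ` T) \<partial>gaussP K)
       \<le> (\<integral>g. Max ((\<lambda>t. \<Sum>k\<in>K. v t k * g k) ` T) \<partial>gaussP K)"
    (is "?U \<le> ?V")
proof (rule field_le_epsilon)
  fix e :: real assume e: "0 < e"
  interpret prob_space "gaussP K"
    by (rule prob_space_gaussP)
  \<comment> \<open>This makes \<open>ln (card T)\<close> at most \<open>b * e\<close>; the added 1
    keeps \<open>b\<close> positive when \<open>T\<close> is a singleton.\<close>
  define b where "b = (ln (card T) + 1) / e"
  have c: "0 \<le> ln (real (card T))"
    using T by (intro ln_ge_zero) (simp add: Suc_le_eq card_gt_0_iff)
  have b: "0 < b"
    using c e by (simp add: b_def)
  have scale: "(\<Sum>k\<in>K. (b * w k) * g k) = b * (\<Sum>k\<in>K. w k * g k)" for w g :: "'k \<Rightarrow> real"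
    by (simp add: sum_distrib_left mult.assoc)
  note lse = integrable_ln_sum_exp[OF T, of K "\<lambda>t k. b * _ t k", unfolded scale]
  have iM: "integrable (gaussP K) (\<lambda>g. Max ((\<lambda>t. \<Sum>k\<in>K. w t k * g k) ` T))"
    for w :: "'t \<Rightarrow> 'k \<Rightarrow> real"
    by (intro integrable_Max T integrable_gaussP_linear)
  have "b * ?U = (\<integral>g. b * Max ((\<lambda>t. \<Sum>k\<in>K. u t k * g k) ` T) \<partial>gaussP K)"
    by simp
  also have "\<dots> \<le> (\<integral>g. ln (\<Sum>t\<in>T. exp (b * (\<Sum>k\<in>K. u t k * g k))) \<partial>gaussP K)"
    by (intro integral_mono lse integrable_mult_right iM ln_sum_exp_bounds T b)
  also have "\<dots> \<le> (\<integral>g. ln (\<Sum>t\<in>T. exp (b * (\<Sum>k\<in>K. v t k * g k))) \<partial>gaussP K)"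
  proof -
    have "(\<Sum>k\<in>K. (b * u s k) * (b * v t k)) = b\<^sup>2 * (\<Sum>k\<in>K. u s k * v t k)" for s t
      by (simp add: sum_distrib_left power2_eq_square ac_simps)
    moreover have "(\<Sum>k\<in>K. (b * f s k - b * f t k)\<^sup>2) = b\<^sup>2 * (\<Sum>k\<in>K. (f s k - f t k)\<^sup>2)"
      for s t and f :: "'t \<Rightarrow> 'k \<Rightarrow> real"
      by (simp add: sum_distrib_left power_mult_distrib flip: right_diff_distrib)
    ultimately show ?thesis
      using ln_sum_exp_gaussian_comparison[OF T K, of "\<lambda>t k. b * u t k" "\<lambda>t k. b * v t k"]
      by (simp add: scale orth incr mult_left_mono)
  qed
  also have "\<dots> \<le> (\<integral>g. b * Max ((\<lambda>t. \<Sum>k\<in>K. v t k * g k) ` T) + ln (card T) \<partial>gaussP K)"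
    by (intro integral_mono lse Bochner_Integration.integrable_add integrable_mult_right iM
        integrable_const ln_sum_exp_bounds T b)
  also have "\<dots> = b * ?V + ln (card T)"
    using iM by (simp add: prob_space)
  finally have "b * ?U \<le> b * ?V + ln (card T)" .
  also have "\<dots> \<le> b * (?V + e)"
    using e c by (simp add: b_def distrib_left)
  finally show "?U \<le> ?V + e"
    using b by simp
qed

section \<open>Norms on coordinate subsets\<close>

lemma lnorm_infinity: "lnorm \<infinity> J x = Max ((\<lambda>j. \<bar>x j\<bar>) ` J)"
  by (simp add: lnorm_def)

lemma lnorm_ereal: "lnorm (ereal r) J x = (\<Sum>j\<in>J. \<bar>x j\<bar> powr r) powr (1 / r)"
  by (simp add: lnorm_def)

lemma lnorm_1: "lnorm 1 J x = (\<Sum>j\<in>J. \<bar>x j\<bar>)"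
  using lnorm_ereal[of 1 J x] by (simp add: one_ereal_def sum_nonneg)

lemma lnorm_nonneg: "finite J \<Longrightarrow> J \<noteq> {} \<Longrightarrow> 0 \<le> lnorm s J x"
  unfolding lnorm_def by (auto simp: Max_ge_iff ex_in_conv)

lemma lnorm_ereal_le_1_iff:
  assumes "0 < r"
  shows "lnorm (ereal r) J x \<le> 1 \<longleftrightarrow> (\<Sum>j\<in>J. \<bar>x j\<bar> powr r) \<le> 1"
proof -
  have "a powr (1/r) \<le> 1 \<longleftrightarrow> a \<le> 1" if "0 \<le> a" for a :: real
  proof
    assume "a powr (1/r) \<le> 1"
    then have "(a powr (1/r)) powr r \<le> 1 powr r"
      using assms by (intro powr_mono2) auto
    then show "a \<le> 1"
      using assms that by (simp add: powr_powr)
  next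
    assume "a \<le> 1"
    then have "a powr (1/r) \<le> 1 powr (1/r)"
      using assms that by (intro powr_mono2) auto
    then show "a powr (1/r) \<le> 1" by simp
  qed
  then show ?thesis
    by (simp add: lnorm_ereal sum_nonneg)
qed

lemma pos_ereal_cases:
  assumes "0 < (s :: ereal)"
  obtains "s = \<infinity>" | r where "s = ereal r" "0 < r"
  using assms by (cases s) auto

lemma lnorm_mono:
  assumes "finite J" "J \<noteq> {}" "0 < s" "\<And>j. j \<in> J \<Longrightarrow> \<bar>x j\<bar> \<le> \<bar>y j\<bar>"
  shows "lnorm s J x \<le> lnorm s J y"
  using \<open>0 < s\<close>
proof (cases rule: pos_ereal_cases)
  case 1
  then show ?thesis
    using assms by (auto simp: lnorm_infinity intro!: order_trans[OF assms(4) Max_ge])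
next
  case (2 r)
  then show ?thesis
    using assms by (auto simp: lnorm_ereal intro!: powr_mono2 sum_mono sum_nonneg)
qed

lemma abs_le_1_if_lnorm_le_1:
  assumes "finite J" "0 < s" "lnorm s J x \<le> 1" "j \<in> J"
  shows "\<bar>x j\<bar> \<le> 1"
  using \<open>0 < s\<close>
proof (cases rule: pos_ereal_cases)
  case 1
  have "\<bar>x j\<bar> \<le> Max ((\<lambda>j. \<bar>x j\<bar>) ` J)"
    using assms by (intro Max_ge) auto
  also have "\<dots> \<le> 1"
    using assms 1 by (simp add: lnorm_infinity)
  finally show ?thesis .
next
  case (2 r)
  have "\<bar>x j\<bar> powr r \<le> (\<Sum>j\<in>J. \<bar>x j\<bar> powr r)"
    using assms by (intro member_le_sum) auto
  also have "\<dots> \<le> 1"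
    using assms 2 by (simp add: lnorm_ereal_le_1_iff)
  finally have "lnorm (ereal r) {j} x \<le> 1"
    using 2 by (simp add: lnorm_ereal_le_1_iff)
  then show ?thesis
    using 2 by (simp add: lnorm_ereal powr_powr)
qed

text \<open>This is the origin of the halved exponents: squaring coordinates maps the unit ball for
  \<open>s\<close> into the unit ball for \<open>s / 2\<close>.\<close>

lemma lnorm_half_power2:
  assumes "finite J" "J \<noteq> {}" "0 < s"
  shows "lnorm (s / 2) J (\<lambda>j. (x j)\<^sup>2) = (lnorm s J x)\<^sup>2"
  using \<open>0 < s\<close>
proof (cases rule: pos_ereal_cases)
  case 1
  \<comment> \<open>Squaring is monotone only on nonnegative reals; composing it with
    \<open>max 0\<close> gives a function monotone on the whole line, which therefore commutes with
    \<open>Max\<close>.\<close>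
  have "(Max ((\<lambda>j. \<bar>x j\<bar>) ` J))\<^sup>2 = (max 0 (Max ((\<lambda>j. \<bar>x j\<bar>) ` J)))\<^sup>2"
    using lnorm_nonneg[OF assms(1,2), of \<infinity> x] by (simp add: lnorm_infinity max_absorb2)
  also have "\<dots> = Max ((\<lambda>a. (max 0 a)\<^sup>2) ` (\<lambda>j. \<bar>x j\<bar>) ` J)"
    using assms by (intro mono_Max_commute) (auto simp: mono_def intro!: power_mono)
  finally show ?thesis
    using 1 by (simp add: lnorm_infinity image_image)
next
  case (2 r)
  have s2: "s / 2 = ereal (r / 2)"
    using 2 by simp
  have "\<bar>a\<^sup>2\<bar> powr (r / 2) = \<bar>a\<bar> powr r" for a :: real
  proof -
    have "\<bar>a\<^sup>2\<bar> = \<bar>a\<bar> powr 2"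
      by (cases "a = 0") (auto simp: powr_numeral)
    then have "\<bar>a\<^sup>2\<bar> powr (r / 2) = (\<bar>a\<bar> powr 2) powr (r / 2)"
      by (simp only:)
    then show ?thesis
      by (simp only: powr_powr) simp
  qed
  moreover have "S powr (2 / r) = (S powr (1 / r))\<^sup>2" for S :: real
    by (simp add: power2_eq_square flip: powr_add)
  ultimately show ?thesis
    unfolding s2 unfolding 2(1) lnorm_ereal by (simp only: divide_divide_eq_right mult_1)
qed

section \<open>Hoelder duality and the bilinear form of the operator norm\<close>

lemma hconj_cases [consumes 1, case_names one infinity finite]:
  assumes "1 \<le> p"
  obtains "p = 1" "hconj p = \<infinity>" | "p = \<infinity>" "hconj p = 1"
  | r s where "p = ereal r" "hconj p = ereal s" "1 < r" "1 < s" "1 / r + 1 / s = 1"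
proof (cases p)
  case (real r)
  show ?thesis
  proof (cases "r = 1")
    case True
    then show ?thesis
      using real that(1) by (simp add: hconj_def one_ereal_def)
  next
    case False
    then have r: "1 < r"
      using assms real by (simp add: one_ereal_def)
    have "hconj p = ereal (r / (r - 1))"
      using real r by (simp add: hconj_def one_ereal_def)
    then show ?thesis
      using real r by (intro that(3)[of r "r / (r - 1)"]) (auto simp: field_simps)
  qed
qed (use assms that(2) in \<open>auto simp: hconj_def\<close>)

lemma hconj_ge_1: "1 \<le> p \<Longrightarrow> 1 \<le> hconj p"
  by (cases p rule: hconj_cases) (auto simp: one_ereal_def)

lemma hconj_hconj:
  assumes "1 \<le> p"
  shows "hconj (hconj p) = p"
  using assms
proof (cases p rule: hconj_cases)
  case (finite r s)
  then have "s / (s - 1) = r"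
    by (simp add: field_simps)
  then show ?thesis
    using finite by (simp add: hconj_def one_ereal_def)
qed (auto simp: hconj_def)

lemma holder_lnorm:
  assumes "1 \<le> p" and J: "finite J" "J \<noteq> {}" and x: "lnorm p J x \<le> 1"
  shows "(\<Sum>j\<in>J. \<bar>x j\<bar> * \<bar>c j\<bar>) \<le> lnorm (hconj p) J c"
  using \<open>1 \<le> p\<close>
proof (cases p rule: hconj_cases)
  case one
  have "(\<Sum>j\<in>J. \<bar>x j\<bar> * \<bar>c j\<bar>) \<le> (\<Sum>j\<in>J. \<bar>x j\<bar> * lnorm \<infinity> J c)"
    using J by (intro sum_mono mult_left_mono) (auto simp: lnorm_infinity)
  also have "\<dots> = (\<Sum>j\<in>J. \<bar>x j\<bar>) * lnorm \<infinity> J c"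
    by (simp add: sum_distrib_right)
  also have "\<dots> \<le> 1 * lnorm \<infinity> J c"
    using x one J by (intro mult_right_mono lnorm_nonneg) (auto simp: lnorm_1)
  finally show ?thesis
    using one by simp
next
  case infinity
  have "\<bar>x j\<bar> \<le> 1" if "j \<in> J" for j
    using abs_le_1_if_lnorm_le_1[OF J(1) _ x that] \<open>1 \<le> p\<close> by (simp add: infinity)
  then show ?thesis
    unfolding infinity(2) lnorm_1 by (intro sum_mono mult_left_le_one_le) auto
next
  case (finite r s)
  define C where "C = lnorm (hconj p) J c"
  have C0: "0 \<le> C"
    unfolding C_def using J by (rule lnorm_nonneg)
  have sum_c: "(\<Sum>j\<in>J. \<bar>c j\<bar> powr s) = C powr s"
    using finite by (simp add: C_def lnorm_ereal powr_powr sum_nonneg)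
  show ?thesis
  proof (cases "C = 0")
    case True
    then have "\<forall>j\<in>J. \<bar>c j\<bar> powr s = 0"
      using sum_c sum_nonneg_eq_0_iff[OF J(1), of "\<lambda>j. \<bar>c j\<bar> powr s"] by simp
    then show ?thesis
      using True by (simp add: C_def)
  next
    case False
    then have C: "0 < C"
      using C0 by simp
    \<comment> \<open>After \<open>c\<close> is divided by its norm \<open>C\<close>, the two sums
      coming from Young's inequality are at most \<open>1 / r\<close> and
      \<open>1 / s\<close>.\<close>
    have "(\<Sum>j\<in>J. \<bar>x j\<bar> * (\<bar>c j\<bar> / C)) \<le> (\<Sum>j\<in>J. \<bar>x j\<bar> powr r / r + (\<bar>c j\<bar> / C) powr s / s)"
      using finite C by (intro sum_mono Youngs_inequality) auto
    also have "\<dots> = (\<Sum>j\<in>J. \<bar>x j\<bar> powr r) / r + (\<Sum>j\<in>J. \<bar>c j\<bar> powr s) / C powr s / s"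
      using C by (simp add: sum.distrib powr_divide sum_divide_distrib)
    also have "\<dots> \<le> 1 / r + 1 / s"
      using x finite C unfolding sum_c
      by (intro add_mono divide_right_mono) (auto simp: lnorm_ereal_le_1_iff)
    finally have "(\<Sum>j\<in>J. \<bar>x j\<bar> * \<bar>c j\<bar>) / C \<le> 1"
      using finite by (simp add: sum_divide_distrib)
    then show ?thesis
      using C by (simp add: C_def)
  qed
qed

lemma holder_lnorm_sharp:
  assumes "1 \<le> p" and J: "finite J" "J \<noteq> {}"
  obtains x where "lnorm p J x \<le> 1" "(\<Sum>j\<in>J. x j * c j) = lnorm (hconj p) J c"
  using \<open>1 \<le> p\<close>
proof (cases p rule: hconj_cases)
  case one
  have "Max ((\<lambda>j. \<bar>c j\<bar>) ` J) \<in> (\<lambda>j. \<bar>c j\<bar>) ` J"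
    using J by (intro Max_in) auto
  then obtain i where i: "i \<in> J" "lnorm \<infinity> J c = \<bar>c i\<bar>"
    by (auto simp: lnorm_infinity)
  show ?thesis
  proof (rule that)
    show "lnorm p J (\<lambda>j. if j = i then sgn (c i) else 0) \<le> 1"
      using one J i by (auto simp: lnorm_1 if_distrib[of abs] abs_sgn_eq cong: if_cong)
    have "(\<Sum>j\<in>J. (if j = i then sgn (c i) else 0) * c j) = (\<Sum>j\<in>J. if j = i then \<bar>c i\<bar> else 0)"
      by (intro sum.cong) (auto simp: abs_sgn mult.commute)
    then show "(\<Sum>j\<in>J. (if j = i then sgn (c i) else 0) * c j) = lnorm (hconj p) J c"
      using one J i by simp
  qed
next
  case infinity
  show ?thesis
  proof (rule that)
    show "lnorm p J (\<lambda>j. sgn (c j)) \<le> 1"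
      using infinity J by (auto simp: lnorm_infinity abs_sgn_eq)
    show "(\<Sum>j\<in>J. sgn (c j) * c j) = lnorm (hconj p) J c"
      using infinity by (simp add: lnorm_1 abs_sgn mult.commute)
  qed
next
  case (finite r s)
  define C where "C = lnorm (hconj p) J c"
  have C0: "0 \<le> C"
    unfolding C_def using J by (rule lnorm_nonneg)
  have sum_c: "(\<Sum>j\<in>J. \<bar>c j\<bar> powr s) = C powr s"
    using finite by (simp add: C_def lnorm_ereal powr_powr sum_nonneg)
  show ?thesis
  proof (cases "C = 0")
    case True
    show ?thesis
      using True finite by (intro that[of "\<lambda>_. 0"]) (auto simp: C_def lnorm_ereal)
  next
    case False
    then have C: "0 < C"
      using C0 by simp
    have sr: "(s - 1) * r = s"
      using finite by (simp add: field_simps)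
    \<comment> \<open>Equality in Young's inequality requires \<open>\<bar>x j\<bar> powr r\<close>
      to equal \<open>(\<bar>c j\<bar> / C) powr s\<close>, and
      \<open>(s - 1) * r = s\<close>.\<close>
    define x where "x j = sgn (c j) * (\<bar>c j\<bar> / C) powr (s - 1)" for j
    have "\<bar>x j\<bar> powr r = \<bar>c j\<bar> powr s / C powr s" for j
      using C finite
      by (cases "c j = 0") (auto simp: x_def abs_mult abs_sgn_eq powr_powr sr powr_divide)
    then have "(\<Sum>j\<in>J. \<bar>x j\<bar> powr r) = 1"
      using C sum_c by (simp flip: sum_divide_distrib)
    then have 1: "lnorm p J x \<le> 1"
      using finite by (simp add: lnorm_ereal_le_1_iff)
    have "x j * c j = \<bar>c j\<bar> powr s / C powr (s - 1)" for j
    proof (cases "c j = 0")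
      case False
      have "x j * c j = \<bar>c j\<bar> * \<bar>c j\<bar> powr (s - 1) / C powr (s - 1)"
        using C by (simp add: x_def powr_divide abs_sgn mult_ac)
      also have "\<bar>c j\<bar> * \<bar>c j\<bar> powr (s - 1) = \<bar>c j\<bar> powr s"
        using False by (simp add: powr_mult_base)
      finally show ?thesis .
    qed (use finite in auto)
    then have "(\<Sum>j\<in>J. x j * c j) = C powr s / C powr (s - 1)"
      by (simp add: sum_c flip: sum_divide_distrib)
    also have "\<dots> = C"
      using C by (simp flip: powr_diff)
    finally show ?thesis
      using 1 by (intro that) (auto simp: C_def)
  qed
qed

text \<open>By \<open>holder_lnorm_sharp\<close> each member of the left set is a member of the
  right one, and by \<open>holder_lnorm\<close> each member of the right set is dominated by one of
  the left. So the two sets have the same upper bounds, and these determine the real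
  \<open>Sup\<close>.\<close>

lemma opnorm_eq_Sup_bilinear:
  assumes "1 \<le> q" and I: "finite I" "I \<noteq> {}"
  shows "opnorm B p q I J = Sup {\<Sum>i\<in>I. \<Sum>j\<in>J. y i * B i j * x j | x y.
    lnorm p J x \<le> 1 \<and> lnorm (hconj q) I y \<le> 1}" (is "_ = Sup ?Y")
proof -
  let ?X = "{lnorm q I (\<lambda>i. \<Sum>j\<in>J. B i j * x j) | x. lnorm p J x \<le> 1}"
  have bilin: "(\<Sum>i\<in>I. \<Sum>j\<in>J. y i * B i j * x j) = (\<Sum>i\<in>I. y i * (\<Sum>j\<in>J. B i j * x j))" for x y
    by (simp add: sum_distrib_left mult.assoc)
  have "?X \<subseteq> ?Y"
  proof clarify
    fix x assume x: "lnorm p J x \<le> 1"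
    obtain y where "lnorm (hconj q) I y \<le> 1"
      "(\<Sum>i\<in>I. y i * (\<Sum>j\<in>J. B i j * x j)) = lnorm q I (\<lambda>i. \<Sum>j\<in>J. B i j * x j)"
      using holder_lnorm_sharp[OF hconj_ge_1[OF assms(1)] I, of "\<lambda>i. \<Sum>j\<in>J. B i j * x j"]
      unfolding hconj_hconj[OF assms(1)] by blast
    then show "\<exists>x' y. lnorm q I (\<lambda>i. \<Sum>j\<in>J. B i j * x j) = (\<Sum>i\<in>I. \<Sum>j\<in>J. y i * B i j * x' j)
        \<and> lnorm p J x' \<le> 1 \<and> lnorm (hconj q) I y \<le> 1"
      unfolding bilin using x by (intro exI[of _ x] exI[of _ y]) simp
  qed
  moreover have "\<exists>a\<in>?X. b \<le> a" if b': "b \<in> ?Y" for b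
  proof -
    obtain x y where b: "b = (\<Sum>i\<in>I. y i * (\<Sum>j\<in>J. B i j * x j))"
      and xy: "lnorm p J x \<le> 1" "lnorm (hconj q) I y \<le> 1"
      using b' unfolding bilin by blast
    have "b \<le> (\<Sum>i\<in>I. \<bar>y i\<bar> * \<bar>\<Sum>j\<in>J. B i j * x j\<bar>)"
      unfolding b by (intro sum_mono) (metis abs_ge_self abs_mult)
    also have "\<dots> \<le> lnorm q I (\<lambda>i. \<Sum>j\<in>J. B i j * x j)"
      using holder_lnorm[OF hconj_ge_1[OF assms(1)] I xy(2)] unfolding hconj_hconj[OF assms(1)] .
    finally show ?thesis
      using xy by blast
  qed
  ultimately have "(\<forall>a\<in>?X. a \<le> z) \<longleftrightarrow> (\<forall>b\<in>?Y. b \<le> z)" for z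
    by (meson order_trans subsetD)
  then show ?thesis
    by (simp add: opnorm_def Sup_real_def)
qed

text \<open>A real \<open>Sup\<close> is an upper bound only of a bounded set. Even for
  \<open>s < 1\<close>, where the unit ball need not be convex, all its points have coordinates in
  \<open>[-1, 1]\<close>, so absolute row sums bound every image.\<close>

lemma bdd_above_opnorm:
  assumes I: "finite I" "I \<noteq> {}" and J: "finite J" and st: "0 < s" "0 < t"
  shows "bdd_above {lnorm t I (\<lambda>i. \<Sum>j\<in>J. B i j * x j) | x. lnorm s J x \<le> 1}"
proof (rule bdd_aboveI)
  fix a assume "a \<in> {lnorm t I (\<lambda>i. \<Sum>j\<in>J. B i j * x j) | x. lnorm s J x \<le> 1}"
  then obtain x where a: "a = lnorm t I (\<lambda>i. \<Sum>j\<in>J. B i j * x j)" and x: "lnorm s J x \<le> 1"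
    by auto
  have "\<bar>\<Sum>j\<in>J. B i j * x j\<bar> \<le> (\<Sum>j\<in>J. \<bar>B i j\<bar>)" for i
    using abs_le_1_if_lnorm_le_1[OF J st(1) x]
    by (intro order_trans[OF sum_abs] sum_mono) (auto simp: abs_mult intro!: mult_right_le_one_le)
  then have "\<bar>\<Sum>j\<in>J. B i j * x j\<bar> \<le> \<bar>\<Sum>j\<in>J. \<bar>B i j\<bar>\<bar>" for i
    by (rule order_trans[OF _ abs_ge_self])
  then show "a \<le> lnorm t I (\<lambda>i. \<Sum>j\<in>J. \<bar>B i j\<bar>)"
    unfolding a by (intro lnorm_mono I st)
qed

text \<open>With \<open>v i\<close> the Euclidean norm of row \<open>i\<close> weighted by
  \<open>x\<close>, Hoelder against \<open>y\<close> leaves the \<open>q\<close>-norm of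
  \<open>v\<close>. Its square is the \<open>q / 2\<close>-norm of the squares of \<open>v\<close>,
  and these are the entrywise square of \<open>B\<close> applied to the squares of \<open>x\<close>,
  a point of the unit ball for \<open>p / 2\<close>.\<close>

lemma sum_abs_mult_row_norm_le:
  assumes pq: "1 \<le> p" "1 \<le> q" and I: "finite I" "I \<noteq> {}" and J: "finite J" "J \<noteq> {}"
    and x: "lnorm p J x \<le> 1" and y: "lnorm (hconj q) I y \<le> 1"
  shows "(\<Sum>i\<in>I. \<bar>y i\<bar> * sqrt (\<Sum>j\<in>J. (B i j)\<^sup>2 * (x j)\<^sup>2))
    \<le> sqrt (opnorm (\<lambda>i j. (B i j)\<^sup>2) (p / 2) (q / 2) I J)"
proof -
  define v where "v i = sqrt (\<Sum>j\<in>J. (B i j)\<^sup>2 * (x j)\<^sup>2)" for i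
  have pos: "0 < p" "0 < q"
    using pq less_le_trans[of "0::ereal" 1] by auto
  then have pos2: "0 < p / 2" "0 < q / 2"
    by (auto simp: ereal_divide_eq zero_less_divide_iff elim!: pos_ereal_cases)
  have "(\<Sum>i\<in>I. \<bar>y i\<bar> * v i) = (\<Sum>i\<in>I. \<bar>y i\<bar> * \<bar>v i\<bar>)"
    by (simp add: v_def sum_nonneg)
  also have "\<dots> \<le> lnorm q I v"
    using holder_lnorm[OF hconj_ge_1[OF pq(2)] I y] by (simp add: hconj_hconj pq)
  also have "\<dots> = sqrt ((lnorm q I v)\<^sup>2)"
    using I by (simp add: lnorm_nonneg)
  also have "(lnorm q I v)\<^sup>2 = lnorm (q / 2) I (\<lambda>i. (v i)\<^sup>2)"
    by (rule lnorm_half_power2[OF I pos(2), symmetric])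
  also have "(\<lambda>i. (v i)\<^sup>2) = (\<lambda>i. \<Sum>j\<in>J. (B i j)\<^sup>2 * (x j)\<^sup>2)"
    by (simp add: v_def sum_nonneg)
  also have "lnorm (q / 2) I \<dots> \<le> opnorm (\<lambda>i j. (B i j)\<^sup>2) (p / 2) (q / 2) I J"
    unfolding opnorm_def
  proof (rule cSup_upper)
    show "bdd_above {lnorm (q / 2) I (\<lambda>i. \<Sum>j\<in>J. (B i j)\<^sup>2 * x j) | x. lnorm (p / 2) J x \<le> 1}"
      by (intro bdd_above_opnorm I J pos2)
    have "lnorm (p / 2) J (\<lambda>j. (x j)\<^sup>2) \<le> 1"
      unfolding lnorm_half_power2[OF J pos(1)] using x J by (intro power_le_one lnorm_nonneg)
    then show "lnorm (q / 2) I (\<lambda>i. \<Sum>j\<in>J. (B i j)\<^sup>2 * (x j)\<^sup>2)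
        \<in> {lnorm (q / 2) I (\<lambda>i. \<Sum>j\<in>J. (B i j)\<^sup>2 * x j) | x. lnorm (p / 2) J x \<le> 1}"
      by (intro CollectI exI[of _ "\<lambda>j. (x j)\<^sup>2"]) simp
  qed
  finally show ?thesis
    by (simp add: v_def)
qed

text \<open>\<open>harm n - ln n\<close> decreases from its value 1 at \<open>n = 1\<close>, and
  \<open>1 + ln n\<close> is the right side.\<close>

lemma harm_le_ln: "1 \<le> n \<Longrightarrow> harm n \<le> ln (exp 1 * real n)"
  using euler_mascheroni_sequence_decreasing[of 1 n] by (simp add: ln_mult harm_expand)

text \<open>The largest \<open>l\<close> entries of \<open>c\<close> sum up to at most \<open>K l powr (1 - 1 / s)\<close>, so the
  \<open>l\<close>-th largest one is at most \<open>K l powr (- 1 / s)\<close>; the induction peels off the smallest entry.\<close>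

lemma sum_powr_le_if_partial_sums_le:
  assumes "finite J" "1 \<le> s" "0 \<le> K"
    and "\<And>J'. J' \<subseteq> J \<Longrightarrow> J' \<noteq> {} \<Longrightarrow> (\<Sum>j\<in>J'. \<bar>c j\<bar>) \<le> K * real (card J') powr (1 - 1 / s)"
  shows "(\<Sum>j\<in>J. \<bar>c j\<bar> powr s) \<le> K powr s * harm (card J)"
  using assms(1,4)
proof (induction J rule: finite_psubset_induct)
  case (psubset J)
  show ?case
  proof (cases "J = {}")
    case False
    define l where "l = real (card J)"
    have l: "0 < l"
      using psubset.hyps False by (simp add: l_def card_gt_0_iff)
    obtain i where i: "i \<in> J" "\<And>j. j \<in> J \<Longrightarrow> \<bar>c i\<bar> \<le> \<bar>c j\<bar>"
      using ex_min_if_finite[of "(\<lambda>j. \<bar>c j\<bar>) ` J"] psubset.hyps False by (force simp: not_less)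
    \<comment> \<open>The smallest of the \<open>l\<close> entries is at most their mean; its power
      \<open>s\<close> becomes the harmonic term \<open>1 / l\<close>.\<close>
    have "l * \<bar>c i\<bar> \<le> (\<Sum>j\<in>J. \<bar>c j\<bar>)"
      using sum_mono[of J "\<lambda>_. \<bar>c i\<bar>" "\<lambda>j. \<bar>c j\<bar>"] i(2) by (simp add: l_def)
    also have "\<dots> \<le> K * l powr (1 - 1 / s)"
      unfolding l_def using False by (intro psubset.prems) auto
    also have "\<dots> = l * (K * l powr (- 1 / s))"
      using l by (simp add: powr_diff powr_minus_divide)
    finally have "\<bar>c i\<bar> powr s \<le> (K * l powr (- 1 / s)) powr s"
      using l \<open>1 \<le> s\<close> by (intro powr_mono2) auto
    also have "\<dots> = K powr s * (1 / l)"
      using \<open>1 \<le> s\<close> \<open>0 \<le> K\<close> l by (simp add: powr_mult powr_divide powr_powr powr_minus_divide)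
    finally have ci: "\<bar>c i\<bar> powr s \<le> K powr s * (1 / l)" .
    have "(\<Sum>j\<in>J - {i}. \<bar>c j\<bar> powr s) \<le> K powr s * harm (card (J - {i}))"
      using i by (intro psubset.IH psubset.prems) auto
    moreover obtain m where m: "card J = Suc m" "card (J - {i}) = m"
      using psubset.hyps i by (metis card_Suc_Diff1)
    moreover have "(\<Sum>j\<in>J. \<bar>c j\<bar> powr s) = \<bar>c i\<bar> powr s + (\<Sum>j\<in>J - {i}. \<bar>c j\<bar> powr s)"
      using psubset.hyps i(1) by (rule sum.remove)
    ultimately show ?thesis
      using ci by (simp add: l_def distrib_left harm_Suc divide_inverse)
  qed (simp add: harm_expand)
qed

text \<open>The hypothesis is what testing \<open>c\<close> against flat vectors provides. For
  finite \<open>s = hconj p\<close> one has \<open>rexp p = 1 - 1 / s\<close>, the harmonic bound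
  controls the sum of \<open>s\<close>-th powers, and the \<open>s\<close>-th root puts the exponent
  \<open>1 / s\<close> on the logarithm. For \<open>p = 1\<close> the singletons already bound the
  maximum.\<close>

lemma lnorm_le_if_partial_sums_le:
  assumes "1 \<le> p" and J: "finite J" "J \<noteq> {}"
    and partial: "\<And>J'. J' \<subseteq> J \<Longrightarrow> J' \<noteq> {} \<Longrightarrow> (\<Sum>j\<in>J'. \<bar>c j\<bar>) \<le> K * real (card J') powr rexp p"
  shows "lnorm (hconj p) J c \<le> ln (exp 1 * real (card J)) powr rexp (hconj p) * K"
proof -
  have card: "1 \<le> card J"
    using J by (simp add: Suc_le_eq card_gt_0_iff)
  \<comment> \<open>For \<open>p = 1\<close> the logarithm appears with exponent 0, and
    \<open>0 powr 0\<close> would be 0.\<close>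
  have ln1: "1 \<le> ln (exp 1 * real (card J))"
    using card by (simp add: ln_mult)
  have single: "\<bar>c j\<bar> \<le> K" if "j \<in> J" for j
    using partial[of "{j}"] that by simp
  then have K: "0 \<le> K"
    using J by (meson abs_ge_zero all_not_in_conv order_trans)
  have fin: ?thesis if s: "hconj p = ereal s" "1 \<le> s" "rexp p = 1 - 1 / s" for s
  proof -
    have "(\<Sum>j\<in>J. \<bar>c j\<bar> powr s) \<le> K powr s * harm (card J)"
      using partial s K J by (intro sum_powr_le_if_partial_sums_le) auto
    also have "\<dots> \<le> K powr s * ln (exp 1 * real (card J))"
      by (intro mult_left_mono harm_le_ln card) auto
    finally have "lnorm (hconj p) J c \<le> (K powr s * ln (exp 1 * real (card J))) powr (1 / s)"
      unfolding s lnorm_ereal using s by (intro powr_mono2) (auto intro: sum_nonneg)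
    also have "\<dots> = ln (exp 1 * real (card J)) powr (1 / s) * K"
      using s K ln1 by (simp add: powr_mult powr_powr)
    finally show ?thesis
      using s by (simp add: rexp_def)
  qed
  show ?thesis
    using \<open>1 \<le> p\<close>
  proof (cases p rule: hconj_cases)
    case one
    then show ?thesis
      using single J ln1 by (simp add: lnorm_infinity rexp_def)
  next
    case infinity
    then show ?thesis
      by (intro fin[of 1]) (auto simp: rexp_def one_ereal_def)
  next
    case (finite r s)
    then show ?thesis
      by (intro fin[of s]) (auto simp: rexp_def)
  qed
qed

section \<open>Comparison of the bilinear process\<close>

lemma (in prob_space) expectation_Max_subgaussian:
  assumes T: "finite T" "T \<noteq> {}"
    and X: "\<And>t. t \<in> T \<Longrightarrow> integrable M (X t)"
    and exp: "\<And>b t. t \<in> T \<Longrightarrow> integrable M (\<lambda>x. exp (b * X t x))"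
    and mgf: "\<And>b t. t \<in> T \<Longrightarrow> (\<integral>x. exp (b * X t x) \<partial>M) \<le> exp (b\<^sup>2 / 2)"
  shows "(\<integral>x. Max ((\<lambda>t. X t x) ` T) \<partial>M) \<le> sqrt (2 * ln (card T))"
proof -
  have c: "1 \<le> real (card T)"
    using T by (simp add: Suc_le_eq card_gt_0_iff)
  have bound: "b * (\<integral>x. Max ((\<lambda>t. X t x) ` T) \<partial>M) \<le> ln (card T) + b\<^sup>2 / 2" if b: "0 < b" for b
  proof -
    \<comment> \<open>\<open>a\<close> bounds the expected sum of exponentials. The tangent of
      \<open>ln\<close> at \<open>a\<close> lies above \<open>ln\<close>; integrating it replaces
      Jensen's inequality and leaves at most \<open>ln a\<close>.\<close>
    define a where "a = card T * exp (b\<^sup>2 / 2)"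
    have a: "0 < a"
      using c by (simp add: a_def)
    have iS: "integrable M (\<lambda>x. \<Sum>t\<in>T. exp (b * X t x))"
      by (intro Bochner_Integration.integrable_sum exp)
    have "b * (\<integral>x. Max ((\<lambda>t. X t x) ` T) \<partial>M) = (\<integral>x. b * Max ((\<lambda>t. X t x) ` T) \<partial>M)"
      by simp
    also have "\<dots> \<le> (\<integral>x. (\<Sum>t\<in>T. exp (b * X t x)) / a + (ln a - 1) \<partial>M)"
    proof (rule integral_mono)
      show "integrable M (\<lambda>x. b * Max ((\<lambda>t. X t x) ` T))"
        by (intro integrable_mult_right integrable_Max T X)
      show "integrable M (\<lambda>x. (\<Sum>t\<in>T. exp (b * X t x)) / a + (ln a - 1))"
        by (intro Bochner_Integration.integrable_add integrable_divide iS integrable_const)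
      fix x
      have S: "0 < (\<Sum>t\<in>T. exp (b * X t x))"
        by (rule sum_exp_pos[OF T])
      have "ln ((\<Sum>t\<in>T. exp (b * X t x)) / a) \<le> (\<Sum>t\<in>T. exp (b * X t x)) / a - 1"
        using S a by (intro ln_le_minus_one) auto
      then show "b * Max ((\<lambda>t. X t x) ` T) \<le> (\<Sum>t\<in>T. exp (b * X t x)) / a + (ln a - 1)"
        using ln_sum_exp_bounds(1)[OF T b, of "\<lambda>t. X t x"] S a by (simp add: ln_div)
    qed
    also have "\<dots> = (\<Sum>t\<in>T. \<integral>x. exp (b * X t x) \<partial>M) / a + (ln a - 1)"
      using iS exp by (simp add: Bochner_Integration.integral_sum prob_space)
    also have "\<dots> \<le> (\<Sum>t\<in>T. exp (b\<^sup>2 / 2)) / a + (ln a - 1)"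
      using a by (intro add_right_mono divide_right_mono sum_mono mgf) auto
    also have "\<dots> = ln (card T) + b\<^sup>2 / 2"
      using c by (simp add: a_def ln_mult)
    finally show ?thesis .
  qed
  show ?thesis
  \<comment> \<open>The optimal \<open>b\<close> is \<open>sqrt (2 * ln (card T))\<close>. For a
    singleton this is 0, and arbitrarily small positive \<open>b\<close> are used instead.\<close>
  proof (cases "card T = 1")
    case True
    show ?thesis
    proof (rule field_le_epsilon)
      fix e :: real assume "0 < e"
      then show "(\<integral>x. Max ((\<lambda>t. X t x) ` T) \<partial>M) \<le> sqrt (2 * ln (card T)) + e"
        using bound[of "2 * e"] True by (simp add: power2_eq_square)
    qed
  next
    case False
    define b where "b = sqrt (2 * ln (card T))"
    have "1 < real (card T)"
      using c False by linarith
    then have b: "0 < b" "b\<^sup>2 = 2 * ln (card T)"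
      by (simp_all add: b_def)
    then have "b * (\<integral>x. Max ((\<lambda>t. X t x) ` T) \<partial>M) \<le> b * b"
      using bound[OF b(1)] by (simp add: power2_eq_square)
    then show ?thesis
      using b(1) by (simp add: b_def[symmetric])
  qed
qed

lemma gaussP_mgf:
  assumes "k \<in> K"
  shows "integrable (gaussP K) (\<lambda>g. exp (c * g k))" "(\<integral>g. exp (c * g k) \<partial>gaussP K) = exp (c\<^sup>2 / 2)"
  using gaussP_component[OF assms, of "\<lambda>x. exp (c * x)"] gauss1_mgf[of c] by simp_all

lemma expectation_Max_gaussP:
  assumes S: "finite S" "S \<noteq> {}" "S \<subseteq> K"
  shows "(\<integral>g. Max (g ` S) \<partial>gaussP K) \<le> sqrt (2 * ln (card S))"
proof -
  interpret prob_space "gaussP K"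
    by (rule prob_space_gaussP)
  show ?thesis
    using S by (intro expectation_Max_subgaussian) (auto simp: gaussP_mgf subset_eq)
qed

text \<open>For a singleton the logarithm vanishes and the exact mean \<open>sqrt (2 / pi)\<close>
  remains. Otherwise the maximum runs over the \<open>2 * card S\<close> variables
  \<open>g k\<close> and \<open>- g k\<close>, and \<open>ln 2 \<le> ln (card S)\<close> brings the
  subgaussian bound down to \<open>2 * sqrt (ln (card S))\<close>.\<close>

lemma expectation_Max_abs_gaussP:
  fixes K S :: "'k set"
  assumes S: "finite S" "S \<noteq> {}" "S \<subseteq> K"
  shows "(\<integral>g. Max ((\<lambda>k. \<bar>g k\<bar>) ` S) \<partial>gaussP K) \<le> 8 * sqrt (ln (card S)) + sqrt (2 / pi)"
proof (cases "card S = 1")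
  case True
  then obtain k where k: "S = {k}"
    by (auto simp: card_Suc_eq)
  then have "(\<integral>g. \<bar>g k\<bar> \<partial>gaussP K) = sqrt (2 / pi)"
    using S gaussP_component(2)[of k K abs] by (simp add: integral_gauss1_abs)
  then show ?thesis
    using k by simp
next
  case False
  interpret prob_space "gaussP K"
    by (rule prob_space_gaussP)
  have c: "2 \<le> card S"
    using S False by (cases "card S" rule: nat.exhaust) (auto simp: Suc_le_eq)
  define X :: "real \<times> 'k \<Rightarrow> ('k \<Rightarrow> real) \<Rightarrow> real" where "X = (\<lambda>(s, k) g. s * g k)"
  let ?T = "{-1, 1 :: real} \<times> S"
  have eq: "Max ((\<lambda>k. \<bar>g k\<bar>) ` S) = Max ((\<lambda>t. X t g) ` ?T)" for g
  proof (rule antisym)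
    show "Max ((\<lambda>k. \<bar>g k\<bar>) ` S) \<le> Max ((\<lambda>t. X t g) ` ?T)"
    proof (rule Max.boundedI)
      fix a assume "a \<in> (\<lambda>k. \<bar>g k\<bar>) ` S"
      then obtain k where "k \<in> S" "a = X (-1, k) g \<or> a = X (1, k) g"
        by (auto simp: X_def abs_if)
      then show "a \<le> Max ((\<lambda>t. X t g) ` ?T)"
        using S by (intro Max_ge) auto
    qed (use S in auto)
    show "Max ((\<lambda>t. X t g) ` ?T) \<le> Max ((\<lambda>k. \<bar>g k\<bar>) ` S)"
    proof (rule Max.boundedI)
      fix a assume "a \<in> (\<lambda>t. X t g) ` ?T"
      then obtain k where k: "k \<in> S" "a \<le> \<bar>g k\<bar>"
        by (auto simp: X_def)
      have "\<bar>g k\<bar> \<le> Max ((\<lambda>k. \<bar>g k\<bar>) ` S)"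
        using S k by (intro Max_ge) auto
      then show "a \<le> Max ((\<lambda>k. \<bar>g k\<bar>) ` S)"
        using k by linarith
    qed (use S in auto)
  qed
  have "(\<integral>g. Max ((\<lambda>t. X t g) ` ?T) \<partial>gaussP K) \<le> sqrt (2 * ln (card ?T))"
  proof (rule expectation_Max_subgaussian)
    fix t assume t: "t \<in> ?T"
    then obtain s k where sk: "t = (s, k)" "s = 1 \<or> s = -1" "k \<in> K"
      using S by auto
    show "integrable (gaussP K) (X t)"
      using sk by (auto simp: X_def)
    show "integrable (gaussP K) (\<lambda>g. exp (b * X t g))" for b
      using gaussP_mgf(1)[OF sk(3), of "b * s"] by (simp add: X_def sk mult.assoc)
    show "(\<integral>g. exp (b * X t g) \<partial>gaussP K) \<le> exp (b\<^sup>2 / 2)" for b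
    proof -
      have "(b * s)\<^sup>2 = b\<^sup>2"
        using sk(2) by auto
      then show ?thesis
        using gaussP_mgf(2)[OF sk(3), of "b * s"] by (simp add: X_def sk(1) mult.assoc)
    qed
  qed (use S in auto)
  also have "\<dots> = sqrt (2 * ln (2 * real (card S)))"
    by (simp add: card_cartesian_product)
  also have "\<dots> \<le> sqrt (4 * ln (card S))"
    using c by (simp add: ln_mult)
  also have "\<dots> = 2 * sqrt (ln (card S))"
    using c by (simp add: real_sqrt_mult)
  also have "\<dots> \<le> 8 * sqrt (ln (card S)) + sqrt (2 / pi)"
    using c by simp
  finally show ?thesis
    by (simp add: eq)
qed

text \<open>If both products are positive, equal moduli force \<open>x = x'\<close> and
  \<open>y = y'\<close>, and the left side is 0. Otherwise at least one conditional is active, and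
  its square alone dominates the left side by the triangle inequality.\<close>

lemma bilinear_increment_le:
  fixes x x' y y' c d :: real
  assumes "\<bar>x\<bar> \<in> {0, c}" "\<bar>x'\<bar> \<in> {0, c}" "\<bar>y\<bar> \<in> {0, d}" "\<bar>y'\<bar> \<in> {0, d}"
  shows "(y * x - y' * x')\<^sup>2 \<le> (if y * y' \<le> 0 then (\<bar>y * x\<bar> + \<bar>y' * x'\<bar>)\<^sup>2 else 0)
    + (if x * x' \<le> 0 then (\<bar>x * y\<bar> + \<bar>x' * y'\<bar>)\<^sup>2 else 0)"
proof (cases "y * y' \<le> 0 \<or> x * x' \<le> 0")
  case True
  define P where "P = (\<bar>y * x\<bar> + \<bar>y' * x'\<bar>)\<^sup>2"
  have "(y * x - y' * x')\<^sup>2 \<le> P"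
    unfolding P_def by (intro abs_le_square_iff[THEN iffD1]) linarith
  moreover have "(\<bar>x * y\<bar> + \<bar>x' * y'\<bar>)\<^sup>2 = P"
    by (simp add: P_def mult.commute)
  moreover have "0 \<le> P"
    by (simp add: P_def)
  ultimately show ?thesis
    using True unfolding P_def[symmetric] by auto
next
  case False
  then have "y = y'" "x = x'"
    using assms by (auto simp: abs_if zero_less_mult_iff not_le split: if_splits)
  then show ?thesis by simp
qed

text \<open>For \<open>y * y' \<le> 0\<close> the two products on the right never share a strict
  sign, so the right side is the square of a sum of two norms and the claim is Minkowski's
  inequality, proved by Cauchy-Schwarz on the cross term. For \<open>y * y' > 0\<close> the left
  side is 0.\<close>

lemma row_increment_ge:
  fixes b :: "nat \<Rightarrow> real"
  shows "(\<Sum>j\<in>J. (b j)\<^sup>2 * (if y * y' \<le> 0 then (\<bar>y * x j\<bar> + \<bar>y' * x' j\<bar>)\<^sup>2 else 0))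
    \<le> (y * L2_set (\<lambda>j. b j * x j) J - y' * L2_set (\<lambda>j. b j * x' j) J)\<^sup>2"
proof (cases "y * y' \<le> 0")
  case True
  let ?s = "L2_set (\<lambda>j. b j * x j) J" and ?s' = "L2_set (\<lambda>j. b j * x' j) J"
  have sq: "?s\<^sup>2 = (\<Sum>j\<in>J. (b j)\<^sup>2 * (x j)\<^sup>2)" "?s'\<^sup>2 = (\<Sum>j\<in>J. (b j)\<^sup>2 * (x' j)\<^sup>2)"
    by (simp_all add: L2_set_def sum_nonneg power_mult_distrib)
  have "(\<Sum>j\<in>J. (b j)\<^sup>2 * (\<bar>y * x j\<bar> + \<bar>y' * x' j\<bar>)\<^sup>2)
      = (\<Sum>j\<in>J. y\<^sup>2 * ((b j)\<^sup>2 * (x j)\<^sup>2) + y'\<^sup>2 * ((b j)\<^sup>2 * (x' j)\<^sup>2)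
          + 2 * (\<bar>y\<bar> * \<bar>y'\<bar>) * (\<bar>b j * x j\<bar> * \<bar>b j * x' j\<bar>))"
  proof (intro sum.cong refl)
    fix j
    have "\<bar>b j * x j\<bar> * \<bar>b j * x' j\<bar> = (b j)\<^sup>2 * (\<bar>x j\<bar> * \<bar>x' j\<bar>)"
      by (simp add: abs_mult power2_eq_square)
    moreover have "(\<bar>y * x j\<bar> + \<bar>y' * x' j\<bar>)\<^sup>2
        = y\<^sup>2 * (x j)\<^sup>2 + y'\<^sup>2 * (x' j)\<^sup>2 + 2 * (\<bar>y\<bar> * \<bar>y'\<bar>) * (\<bar>x j\<bar> * \<bar>x' j\<bar>)"
      by (simp add: power2_sum abs_mult power_mult_distrib)
    ultimately show "(b j)\<^sup>2 * (\<bar>y * x j\<bar> + \<bar>y' * x' j\<bar>)\<^sup>2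
        = y\<^sup>2 * ((b j)\<^sup>2 * (x j)\<^sup>2) + y'\<^sup>2 * ((b j)\<^sup>2 * (x' j)\<^sup>2)
          + 2 * (\<bar>y\<bar> * \<bar>y'\<bar>) * (\<bar>b j * x j\<bar> * \<bar>b j * x' j\<bar>)"
      by (simp add: distrib_left)
  qed
  also have "\<dots> = y\<^sup>2 * ?s\<^sup>2 + y'\<^sup>2 * ?s'\<^sup>2
      + 2 * (\<bar>y\<bar> * \<bar>y'\<bar>) * (\<Sum>j\<in>J. \<bar>b j * x j\<bar> * \<bar>b j * x' j\<bar>)"
    by (simp add: sq sum.distrib sum_distrib_left)
  also have "\<dots> \<le> y\<^sup>2 * ?s\<^sup>2 + y'\<^sup>2 * ?s'\<^sup>2 + 2 * (\<bar>y\<bar> * \<bar>y'\<bar>) * (?s * ?s')"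
    by (intro add_left_mono mult_left_mono L2_set_mult_ineq) auto
  also have "\<bar>y\<bar> * \<bar>y'\<bar> = - (y * y')"
    using True by (simp flip: abs_mult)
  also have "y\<^sup>2 * ?s\<^sup>2 + y'\<^sup>2 * ?s'\<^sup>2 + 2 * - (y * y') * (?s * ?s') = (y * ?s - y' * ?s')\<^sup>2"
    by (simp add: power2_diff power_mult_distrib algebra_simps)
  finally show ?thesis
    using True by simp
qed simp

text \<open>\<open>bilinear_increment_le\<close> splits each entry into a part governed by the signs
  of \<open>y\<close> and one governed by those of \<open>x\<close>. Collected along rows and
  columns respectively, these are the sums that \<open>row_increment_ge\<close> bounds.\<close>

lemma chevet_increment_le:
  fixes b :: "nat \<Rightarrow> nat \<Rightarrow> real"
  assumes "\<And>j. j \<in> J \<Longrightarrow> \<bar>x j\<bar> \<in> {0, c}" "\<And>j. j \<in> J \<Longrightarrow> \<bar>x' j\<bar> \<in> {0, c}"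
    and "\<And>i. i \<in> I \<Longrightarrow> \<bar>y i\<bar> \<in> {0, d}" "\<And>i. i \<in> I \<Longrightarrow> \<bar>y' i\<bar> \<in> {0, d}"
  shows "(\<Sum>i\<in>I. \<Sum>j\<in>J. (b i j * y i * x j - b i j * y' i * x' j)\<^sup>2)
    \<le> (\<Sum>i\<in>I. (y i * L2_set (\<lambda>j. b i j * x j) J - y' i * L2_set (\<lambda>j. b i j * x' j) J)\<^sup>2)
    + (\<Sum>j\<in>J. (x j * L2_set (\<lambda>i. b i j * y i) I - x' j * L2_set (\<lambda>i. b i j * y' i) I)\<^sup>2)"
proof -
  have "(\<Sum>i\<in>I. \<Sum>j\<in>J. (b i j * y i * x j - b i j * y' i * x' j)\<^sup>2)
      = (\<Sum>i\<in>I. \<Sum>j\<in>J. (b i j)\<^sup>2 * (y i * x j - y' i * x' j)\<^sup>2)"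
    by (simp add: mult.assoc flip: right_diff_distrib power_mult_distrib)
  also have "\<dots> \<le> (\<Sum>i\<in>I. \<Sum>j\<in>J. (b i j)\<^sup>2 *
      ((if y i * y' i \<le> 0 then (\<bar>y i * x j\<bar> + \<bar>y' i * x' j\<bar>)\<^sup>2 else 0)
      + (if x j * x' j \<le> 0 then (\<bar>x j * y i\<bar> + \<bar>x' j * y' i\<bar>)\<^sup>2 else 0)))"
    by (intro sum_mono mult_left_mono bilinear_increment_le[of _ c _ _ d] assms) auto
  also have "\<dots> = (\<Sum>i\<in>I. \<Sum>j\<in>J. (b i j)\<^sup>2 *
        (if y i * y' i \<le> 0 then (\<bar>y i * x j\<bar> + \<bar>y' i * x' j\<bar>)\<^sup>2 else 0))
      + (\<Sum>j\<in>J. \<Sum>i\<in>I. (b i j)\<^sup>2 *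
        (if x j * x' j \<le> 0 then (\<bar>x j * y i\<bar> + \<bar>x' j * y' i\<bar>)\<^sup>2 else 0))"
    unfolding distrib_left sum.distrib by (subst (2) sum.swap) (rule refl)
  also have "\<dots> \<le> (\<Sum>i\<in>I. (y i * L2_set (\<lambda>j. b i j * x j) J - y' i * L2_set (\<lambda>j. b i j * x' j) J)\<^sup>2)
    + (\<Sum>j\<in>J. (x j * L2_set (\<lambda>i. b i j * y i) I - x' j * L2_set (\<lambda>i. b i j * y' i) I)\<^sup>2)"
    by (intro add_mono sum_mono row_increment_ge)
  finally show ?thesis .
qed

text \<open>Coordinates \<open>(i, j)\<close> carry the matrix entries; \<open>(i, 0)\<close>, \<open>(0, j)\<close> and
  \<open>(M + k, N + l)\<close> carry the row, column and size-class Gaussians of the dominating process.\<close>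

definition chevet_index :: "nat \<Rightarrow> nat \<Rightarrow> nat \<Rightarrow> nat \<Rightarrow> (nat \<times> nat) set" where
  "chevet_index M N m n = {1..M} \<times> {1..N} \<union> (\<lambda>i. (i, 0)) ` {1..M} \<union> (\<lambda>j. (0, j)) ` {1..N}
    \<union> (\<lambda>(k, l). (M + k, N + l)) ` ({1..m} \<times> {1..n})"

lemma finite_chevet_index: "finite (chevet_index M N m n)"
  by (simp add: chevet_index_def)

lemma sum_chevet_index:
  "sum F (chevet_index M N m n) = (\<Sum>i=1..M. \<Sum>j=1..N. F (i, j)) + (\<Sum>i=1..M. F (i, 0))
    + (\<Sum>j=1..N. F (0, j)) + (\<Sum>(k, l)\<in>{1..m} \<times> {1..n}. F (M + k, N + l))"
  for F :: "nat \<times> nat \<Rightarrow> real"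
proof -
  have "sum F (chevet_index M N m n) = sum F ({1..M} \<times> {1..N}) + sum F ((\<lambda>i. (i, 0)) ` {1..M})
    + sum F ((\<lambda>j. (0, j)) ` {1..N}) + sum F ((\<lambda>(k, l). (M + k, N + l)) ` ({1..m} \<times> {1..n}))"
    unfolding chevet_index_def by (subst sum.union_disjoint; auto)+
  also have "sum F ({1..M} \<times> {1..N}) = (\<Sum>i=1..M. \<Sum>j=1..N. F (i, j))"
    by (simp add: sum.cartesian_product)
  also have "sum F ((\<lambda>i. (i, 0)) ` {1..M}) = (\<Sum>i=1..M. F (i, 0))"
    by (subst sum.reindex) (auto simp: inj_on_def)
  also have "sum F ((\<lambda>j. (0, j)) ` {1..N}) = (\<Sum>j=1..N. F (0, j))"
    by (subst sum.reindex) (auto simp: inj_on_def)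
  also have "sum F ((\<lambda>(k, l). (M + k, N + l)) ` ({1..m} \<times> {1..n}))
      = (\<Sum>(k, l)\<in>{1..m} \<times> {1..n}. F (M + k, N + l))"
    by (subst sum.reindex) (auto simp: inj_on_def intro!: sum.cong)
  finally show ?thesis .
qed

lemma sum_single_diff_power2:
  fixes a :: real
  assumes "finite P" "k \<in> P" "l \<in> P" "k \<noteq> l"
  shows "(\<Sum>p\<in>P. ((if p = k then a else 0) - (if p = l then a else 0))\<^sup>2) = 2 * a\<^sup>2"
proof -
  have "(\<Sum>p\<in>P. ((if p = k then a else 0) - (if p = l then a else 0))\<^sup>2)
      = (\<Sum>p\<in>P. (if p = k then a\<^sup>2 else 0) + (if p = l then a\<^sup>2 else 0))"
    using assms by (intro sum.cong) auto
  also have "\<dots> = 2 * a\<^sup>2"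
    using assms by (simp add: sum.distrib)
  finally show ?thesis .
qed

lemma sum_mult_le_Max_abs:
  fixes g w :: "nat \<Rightarrow> real"
  assumes "finite I" "(\<Sum>i\<in>I. \<bar>w i\<bar>) \<le> D" "I \<noteq> {}"
  shows "(\<Sum>i\<in>I. w i * g i) \<le> D * Max ((\<lambda>i. \<bar>g i\<bar>) ` I)"
proof -
  have g: "\<bar>g i\<bar> \<le> Max ((\<lambda>i. \<bar>g i\<bar>) ` I)" if "i \<in> I" for i
    using assms that by (intro Max_ge) auto
  have Max: "0 \<le> Max ((\<lambda>i. \<bar>g i\<bar>) ` I)"
    using assms(3) g by (meson abs_ge_zero all_not_in_conv order_trans)
  have "(\<Sum>i\<in>I. w i * g i) \<le> (\<Sum>i\<in>I. \<bar>w i\<bar> * \<bar>g i\<bar>)"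
    by (intro sum_mono) (metis abs_ge_self abs_mult)
  also have "\<dots> \<le> (\<Sum>i\<in>I. \<bar>w i\<bar> * Max ((\<lambda>i. \<bar>g i\<bar>) ` I))"
    by (intro sum_mono mult_left_mono g) auto
  also have "\<dots> \<le> D * Max ((\<lambda>i. \<bar>g i\<bar>) ` I)"
    unfolding sum_distrib_right[symmetric] using assms Max by (intro mult_right_mono)
  finally show ?thesis .
qed

text \<open>The left side is the variance of one member of the bilinear process. It equals a sum of
  squares of nonnegative numbers whose sum is at most \<open>D\<close>.\<close>

lemma sum_bilinear_power2_le:
  fixes b :: "nat \<Rightarrow> nat \<Rightarrow> real"
  assumes "(\<Sum>i\<in>I. \<bar>y i\<bar> * L2_set (\<lambda>j. b i j * x j) J) \<le> D"
  shows "(\<Sum>i\<in>I. \<Sum>j\<in>J. (b i j * y i * x j)\<^sup>2) \<le> D\<^sup>2"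
proof -
  have "(\<Sum>i\<in>I. \<Sum>j\<in>J. (b i j * y i * x j)\<^sup>2) = (\<Sum>i\<in>I. (\<bar>y i\<bar> * L2_set (\<lambda>j. b i j * x j) J)\<^sup>2)"
    by (intro sum.cong refl)
      (simp add: power_mult_distrib L2_set_def sum_nonneg sum_distrib_left mult_ac)
  also have "\<dots> = (L2_set (\<lambda>i. \<bar>y i\<bar> * L2_set (\<lambda>j. b i j * x j) J) I)\<^sup>2"
    by (simp add: L2_set_def sum_nonneg)
  also have "\<dots> \<le> (\<Sum>i\<in>I. \<bar>y i\<bar> * L2_set (\<lambda>j. b i j * x j) J)\<^sup>2"
    by (intro power_mono L2_set_le_sum) auto
  also have "\<dots> \<le> D\<^sup>2"
    using assms by (intro power_mono sum_nonneg) auto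
  finally show ?thesis .
qed

text \<open>Two members of the same class \<open>\<kappa>\<close> are compared by the Chevet increments. Members
  of different classes are separated by an independent Gaussian per class, which costs
  \<open>sqrt 2 * sqrt (2 ln (m n)) \<le> 2.4 sqrt (ln (m n))\<close>.\<close>

lemma expectation_Max_bilinear_le:
  fixes x y :: "'t \<Rightarrow> nat \<Rightarrow> real" and A :: "nat \<Rightarrow> nat \<Rightarrow> real" and \<kappa> :: "'t \<Rightarrow> nat \<times> nat"
  assumes T: "finite T" "T \<noteq> {}" and MN: "1 \<le> M" "1 \<le> N" and mn: "1 \<le> m" "1 \<le> n"
    and \<kappa>: "\<And>t. t \<in> T \<Longrightarrow> \<kappa> t \<in> {1..m} \<times> {1..n}"
    and xc: "\<And>t j. t \<in> T \<Longrightarrow> \<bar>x t j\<bar> \<in> {0, c (\<kappa> t)}"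
    and yd: "\<And>t i. t \<in> T \<Longrightarrow> \<bar>y t i\<bar> \<in> {0, d (\<kappa> t)}"
    and D1: "\<And>t. t \<in> T \<Longrightarrow> (\<Sum>i=1..M. \<bar>y t i\<bar> * L2_set (\<lambda>j. A i j * x t j) {1..N}) \<le> D1"
    and D2: "\<And>t. t \<in> T \<Longrightarrow> (\<Sum>j=1..N. \<bar>x t j\<bar> * L2_set (\<lambda>i. A i j * y t i) {1..M}) \<le> D2"
  defines "K \<equiv> chevet_index M N m n"
  shows "(\<integral>g. Max ((\<lambda>t. \<Sum>i=1..M. \<Sum>j=1..N. A i j * y t i * x t j * g (i, j)) ` T) \<partial>gaussP K)
    \<le> (2.4 * sqrt (ln (real m * real n)) + 8 * sqrt (ln (real M)) + sqrt (2 / pi)) * D1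
      + (8 * sqrt (ln (real N)) + 2 * sqrt (2 / pi)) * D2"
proof -
  interpret prob_space "gaussP K"
    by (rule prob_space_gaussP)
  define u where "u t = (\<lambda>(i, j). if i \<in> {1..M} \<and> j \<in> {1..N} then A i j * y t i * x t j else 0)" for t
  define v where "v t = (\<lambda>(i, j). if j = 0 then y t i * L2_set (\<lambda>j. A i j * x t j) {1..N}
    else if i = 0 then x t j * L2_set (\<lambda>i. A i j * y t i) {1..M}
    else if (i, j) = (M + fst (\<kappa> t), N + snd (\<kappa> t)) then sqrt 2 * D1 else 0)" for t
  have finK: "finite K"
    by (simp add: K_def finite_chevet_index)
  obtain t0 where t0: "t0 \<in> T"
    using T by auto
  have D1_nn: "0 \<le> D1"
    by (rule order_trans[OF _ D1[OF t0]]) (auto intro!: sum_nonneg)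
  have D2_nn: "0 \<le> D2"
    by (rule order_trans[OF _ D2[OF t0]]) (auto intro!: sum_nonneg)
  \<comment> \<open>A general \<open>F\<close> serves both for the squared increments,
    \<open>(a - b)\<^sup>2\<close>, and for the process itself, \<open>a * g k\<close>; the
    condition at \<open>0 0\<close> removes the blocks off the support.\<close>
  have sum_u: "(\<Sum>k\<in>K. F k (u s k) (u t k))
      = (\<Sum>i=1..M. \<Sum>j=1..N. F (i, j) (A i j * y s i * x s j) (A i j * y t i * x t j))"
    if "\<And>k. F k 0 0 = 0" for F :: "nat \<times> nat \<Rightarrow> real \<Rightarrow> real \<Rightarrow> real" and s t
  proof -
    have "(\<Sum>(k, l)\<in>{1..m} \<times> {1..n}. F (M + k, N + l) (u s (M + k, N + l)) (u t (M + k, N + l))) = 0"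
      using that by (intro sum.neutral) (auto simp: u_def)
    then show ?thesis
      unfolding K_def sum_chevet_index using that by (simp add: u_def)
  qed
  have sum_v: "(\<Sum>k\<in>K. F k (v s k) (v t k))
      = (\<Sum>i=1..M. F (i, 0) (y s i * L2_set (\<lambda>j. A i j * x s j) {1..N})
          (y t i * L2_set (\<lambda>j. A i j * x t j) {1..N}))
      + (\<Sum>j=1..N. F (0, j) (x s j * L2_set (\<lambda>i. A i j * y s i) {1..M})
          (x t j * L2_set (\<lambda>i. A i j * y t i) {1..M}))
      + (\<Sum>(k, l)\<in>{1..m} \<times> {1..n}. F (M + k, N + l)
          (if (k, l) = \<kappa> s then sqrt 2 * D1 else 0) (if (k, l) = \<kappa> t then sqrt 2 * D1 else 0))"
    if "\<And>k. F k 0 0 = 0" "s \<in> T" "t \<in> T" for F :: "nat \<times> nat \<Rightarrow> real \<Rightarrow> real \<Rightarrow> real" and s t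
  proof -
    have "(\<Sum>i=1..M. \<Sum>j=1..N. F (i, j) (v s (i, j)) (v t (i, j))) = 0"
      using \<kappa>[OF that(2)] \<kappa>[OF that(3)] that(1) by (auto simp: v_def intro!: sum.neutral)
    moreover have "(\<Sum>i=1..M. F (i, 0) (v s (i, 0)) (v t (i, 0)))
      = (\<Sum>i=1..M. F (i, 0) (y s i * L2_set (\<lambda>j. A i j * x s j) {1..N})
          (y t i * L2_set (\<lambda>j. A i j * x t j) {1..N}))"
      by (simp add: v_def)
    moreover have "(\<Sum>j=1..N. F (0, j) (v s (0, j)) (v t (0, j)))
      = (\<Sum>j=1..N. F (0, j) (x s j * L2_set (\<lambda>i. A i j * y s i) {1..M})
          (x t j * L2_set (\<lambda>i. A i j * y t i) {1..M}))"
      by (intro sum.cong) (auto simp: v_def)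
    moreover have "(\<Sum>(k, l)\<in>{1..m} \<times> {1..n}. F (M + k, N + l) (v s (M + k, N + l)) (v t (M + k, N + l)))
      = (\<Sum>(k, l)\<in>{1..m} \<times> {1..n}. F (M + k, N + l)
          (if (k, l) = \<kappa> s then sqrt 2 * D1 else 0) (if (k, l) = \<kappa> t then sqrt 2 * D1 else 0))"
      by (intro sum.cong refl) (auto simp: v_def prod_eq_iff)
    ultimately show ?thesis
      unfolding K_def sum_chevet_index by simp
  qed
  let ?R = "(\<lambda>i. (i, 0 :: nat)) ` {1..M}" and ?C = "(\<lambda>j. (0 :: nat, j)) ` {1..N}"
    and ?S = "(\<lambda>(k, l). (M + k, N + l)) ` ({1..m} \<times> {1..n})"
  have sub: "?R \<subseteq> K" "?C \<subseteq> K" "?S \<subseteq> K"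
    unfolding K_def chevet_index_def by blast+
  have iR: "integrable (gaussP K) (\<lambda>g. Max ((\<lambda>k. \<bar>g k\<bar>) ` ?R))"
    using sub MN by (intro integrable_Max integrable_abs integrable_gaussP_component) auto
  have iC: "integrable (gaussP K) (\<lambda>g. Max ((\<lambda>k. \<bar>g k\<bar>) ` ?C))"
    using sub MN by (intro integrable_Max integrable_abs integrable_gaussP_component) auto
  have iS: "integrable (gaussP K) (\<lambda>g. Max (g ` ?S))"
    using sub mn by (intro integrable_Max integrable_gaussP_component) auto
  have "(\<integral>g. Max ((\<lambda>t. \<Sum>k\<in>K. u t k * g k) ` T) \<partial>gaussP K)
      \<le> (\<integral>g. Max ((\<lambda>t. \<Sum>k\<in>K. v t k * g k) ` T) \<partial>gaussP K)"
  proof (rule sudakov_fernique[OF T finK])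
    fix s t assume st: "s \<in> T" "t \<in> T"
    \<comment> \<open>Classes are numbered from 1, so the class coordinates lie beyond
      \<open>M\<close> and \<open>N\<close>; thus \<open>u\<close> and \<open>v\<close> live on
      disjoint blocks.\<close>
    show "(\<Sum>k\<in>K. u s k * v t k) = 0"
      using \<kappa>[OF st(2)] by (intro sum.neutral ballI) (auto simp: u_def v_def)
    have u2: "(\<Sum>k\<in>K. (u s k - u t k)\<^sup>2)
        = (\<Sum>i=1..M. \<Sum>j=1..N. (A i j * y s i * x s j - A i j * y t i * x t j)\<^sup>2)"
      by (rule sum_u) simp
    note v2 = sum_v[of "\<lambda>_ a b. (a - b)\<^sup>2", OF _ st, simplified]
    show "(\<Sum>k\<in>K. (u s k - u t k)\<^sup>2) \<le> (\<Sum>k\<in>K. (v s k - v t k)\<^sup>2)"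
    proof (cases "\<kappa> s = \<kappa> t")
      case True
      have "(\<Sum>k\<in>K. (u s k - u t k)\<^sup>2)
          \<le> (\<Sum>i=1..M. (y s i * L2_set (\<lambda>j. A i j * x s j) {1..N} - y t i * L2_set (\<lambda>j. A i j * x t j) {1..N})\<^sup>2)
          + (\<Sum>j=1..N. (x s j * L2_set (\<lambda>i. A i j * y s i) {1..M} - x t j * L2_set (\<lambda>i. A i j * y t i) {1..M})\<^sup>2)"
        unfolding u2 using xc[OF st(1)] xc[OF st(2)] yd[OF st(1)] yd[OF st(2)] unfolding True
        by (intro chevet_increment_le[of _ _ "c (\<kappa> t)" _ _ _ "d (\<kappa> t)"]) auto
      also have "\<dots> \<le> (\<Sum>k\<in>K. (v s k - v t k)\<^sup>2)"
        unfolding v2 by (simp add: sum_nonneg case_prod_beta)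
      finally show ?thesis .
    next
      case False
      have "(\<Sum>k\<in>K. (u s k - u t k)\<^sup>2)
          \<le> (\<Sum>i=1..M. \<Sum>j=1..N. 2 * (A i j * y s i * x s j)\<^sup>2 + 2 * (A i j * y t i * x t j)\<^sup>2)"
      proof -
        have "(a - b)\<^sup>2 \<le> 2 * a\<^sup>2 + 2 * b\<^sup>2" for a b :: real
          using zero_le_power2[of "a + b"] by (simp add: power2_sum power2_diff)
        then show ?thesis
          unfolding u2 by (intro sum_mono)
      qed
      also have "\<dots> = 2 * (\<Sum>i=1..M. \<Sum>j=1..N. (A i j * y s i * x s j)\<^sup>2)
          + 2 * (\<Sum>i=1..M. \<Sum>j=1..N. (A i j * y t i * x t j)\<^sup>2)"
        by (simp add: sum.distrib sum_distrib_left)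
      also have "\<dots> \<le> 2 * D1\<^sup>2 + 2 * D1\<^sup>2"
        by (intro add_mono mult_left_mono sum_bilinear_power2_le D1 st) auto
      \<comment> \<open>Each variance is at most \<open>D1\<^sup>2\<close>, so the increment is at
        most \<open>4 * D1\<^sup>2\<close>. Two independent Gaussians of standard deviation
        \<open>sqrt 2 * D1\<close> match this exactly.\<close>
      also have "\<dots> = 2 * (sqrt 2 * D1)\<^sup>2"
        by (simp add: power_mult_distrib)
      also have "\<dots> = (\<Sum>p\<in>{1..m} \<times> {1..n}.
          ((if p = \<kappa> s then sqrt 2 * D1 else 0) - (if p = \<kappa> t then sqrt 2 * D1 else 0))\<^sup>2)"
        using \<kappa> st False by (intro sum_single_diff_power2[symmetric]) auto
      also have "\<dots> \<le> (\<Sum>k\<in>K. (v s k - v t k)\<^sup>2)"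
        unfolding v2 by (simp add: sum_nonneg case_prod_beta)
      finally show ?thesis .
    qed
  qed
  also have "(\<lambda>g t. \<Sum>k\<in>K. u t k * g k) = (\<lambda>g t. \<Sum>i=1..M. \<Sum>j=1..N. A i j * y t i * x t j * g (i, j))"
    using sum_u[of "\<lambda>k a b. a * _ k"] by (intro ext) simp
  finally have "(\<integral>g. Max ((\<lambda>t. \<Sum>i=1..M. \<Sum>j=1..N. A i j * y t i * x t j * g (i, j)) ` T) \<partial>gaussP K)
      \<le> (\<integral>g. Max ((\<lambda>t. \<Sum>k\<in>K. v t k * g k) ` T) \<partial>gaussP K)" .
  \<comment> \<open>\<open>D1\<close> and \<open>D2\<close> bound absolute sums of coefficients, so
    for each \<open>g\<close> the dependence on \<open>t\<close> disappears into maxima of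
    Gaussians. The class term has a single nonnegative coefficient, hence a maximum without absolute
    values.\<close>
  also have "\<dots> \<le> (\<integral>g. D1 * Max ((\<lambda>k. \<bar>g k\<bar>) ` ?R) + D2 * Max ((\<lambda>k. \<bar>g k\<bar>) ` ?C)
      + sqrt 2 * D1 * Max (g ` ?S) \<partial>gaussP K)"
  proof (rule integral_mono)
    show "integrable (gaussP K) (\<lambda>g. Max ((\<lambda>t. \<Sum>k\<in>K. v t k * g k) ` T))"
      by (intro integrable_Max T integrable_gaussP_linear)
    show "integrable (gaussP K) (\<lambda>g. D1 * Max ((\<lambda>k. \<bar>g k\<bar>) ` ?R) + D2 * Max ((\<lambda>k. \<bar>g k\<bar>) ` ?C)
      + sqrt 2 * D1 * Max (g ` ?S))"
      by (intro Bochner_Integration.integrable_add integrable_mult_right iR iC iS)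
    fix g :: "nat \<times> nat \<Rightarrow> real"
    show "Max ((\<lambda>t. \<Sum>k\<in>K. v t k * g k) ` T) \<le> D1 * Max ((\<lambda>k. \<bar>g k\<bar>) ` ?R)
      + D2 * Max ((\<lambda>k. \<bar>g k\<bar>) ` ?C) + sqrt 2 * D1 * Max (g ` ?S)"
    proof (rule Max.boundedI)
      fix a assume "a \<in> (\<lambda>t. \<Sum>k\<in>K. v t k * g k) ` T"
      then obtain t where t: "t \<in> T" and a: "a = (\<Sum>k\<in>K. v t k * g k)"
        by auto
      obtain k l where kl: "\<kappa> t = (k, l)" "(k, l) \<in> {1..m} \<times> {1..n}"
        using \<kappa>[OF t] by (cases "\<kappa> t") auto
      have "(\<Sum>i=1..M. y t i * L2_set (\<lambda>j. A i j * x t j) {1..N} * g (i, 0))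
          \<le> D1 * Max ((\<lambda>i. \<bar>g (i, 0)\<bar>) ` {1..M})"
        using D1[OF t] MN by (intro sum_mult_le_Max_abs) (auto simp: abs_mult)
      moreover have "(\<Sum>j=1..N. x t j * L2_set (\<lambda>i. A i j * y t i) {1..M} * g (0, j))
          \<le> D2 * Max ((\<lambda>j. \<bar>g (0, j)\<bar>) ` {1..N})"
        using D2[OF t] MN by (intro sum_mult_le_Max_abs) (auto simp: abs_mult)
      moreover have "(\<Sum>(k', l')\<in>{1..m} \<times> {1..n}.
          (if (k', l') = \<kappa> t then sqrt 2 * D1 else 0) * g (M + k', N + l')) = sqrt 2 * D1 * g (M + k, N + l)"
      proof -
        have "(\<Sum>(k', l')\<in>{1..m} \<times> {1..n}.
            (if (k', l') = \<kappa> t then sqrt 2 * D1 else 0) * g (M + k', N + l'))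
          = (\<Sum>p\<in>{1..m} \<times> {1..n}. if p = (k, l) then sqrt 2 * D1 * g (M + k, N + l) else 0)"
          by (intro sum.cong) (auto simp: kl(1) split: if_splits)
        then show ?thesis
          using kl(2) by simp
      qed
      moreover have "sqrt 2 * D1 * g (M + k, N + l) \<le> sqrt 2 * D1 * Max (g ` ?S)"
        using kl(2) D1_nn by (intro mult_left_mono Max_ge) force+
      ultimately show "a \<le> D1 * Max ((\<lambda>k. \<bar>g k\<bar>) ` ?R) + D2 * Max ((\<lambda>k. \<bar>g k\<bar>) ` ?C)
          + sqrt 2 * D1 * Max (g ` ?S)"
        using sum_v[of "\<lambda>k a b. a * g k", OF mult_zero_left t t] unfolding a image_image by linarith
    qed (use T in auto)
  qed
  also have "\<dots> = D1 * (\<integral>g. Max ((\<lambda>k. \<bar>g k\<bar>) ` ?R) \<partial>gaussP K)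
      + D2 * (\<integral>g. Max ((\<lambda>k. \<bar>g k\<bar>) ` ?C) \<partial>gaussP K)
      + sqrt 2 * D1 * (\<integral>g. Max (g ` ?S) \<partial>gaussP K)"
    using iR iC iS by simp
  also have "\<dots> \<le> D1 * (8 * sqrt (ln (card ?R)) + sqrt (2 / pi))
      + D2 * (8 * sqrt (ln (card ?C)) + sqrt (2 / pi)) + sqrt 2 * D1 * sqrt (2 * ln (card ?S))"
    using sub MN mn D1_nn D2_nn
    by (intro add_mono mult_left_mono expectation_Max_abs_gaussP expectation_Max_gaussP) auto
  also have "\<dots> = D1 * (8 * sqrt (ln M) + sqrt (2 / pi))
      + D2 * (8 * sqrt (ln N) + sqrt (2 / pi)) + sqrt 2 * D1 * sqrt (2 * ln (real m * real n))"
    by (simp add: card_image inj_on_def card_cartesian_product split_beta prod_eq_iff)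
  also have "\<dots> = (2 * sqrt (ln (real m * real n)) + 8 * sqrt (ln M) + sqrt (2 / pi)) * D1
      + (8 * sqrt (ln N) + sqrt (2 / pi)) * D2"
    by (simp add: real_sqrt_mult algebra_simps)
  also have "\<dots> \<le> (2.4 * sqrt (ln (real m * real n)) + 8 * sqrt (ln (real M)) + sqrt (2 / pi)) * D1
      + (8 * sqrt (ln (real N)) + 2 * sqrt (2 / pi)) * D2"
  proof -
    have "1 * 1 \<le> real m * real n"
      using mn by (intro mult_mono) auto
    then show ?thesis
      using D1_nn D2_nn MN by (intro add_mono mult_right_mono) auto
  qed
  finally show ?thesis .
qed

section \<open>Flat sign vectors\<close>

definition signvecs :: "nat \<Rightarrow> nat \<Rightarrow> (nat \<Rightarrow> real) set" where
  "signvecs K r = {e. range e \<subseteq> {-1, 0, 1} \<and> {i. e i \<noteq> 0} \<subseteq> {1..K}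
    \<and> card {i. e i \<noteq> 0} \<in> {1..r}}"

text \<open>The scaling makes the norm for the exponent \<open>s\<close> equal to 1 on the support;
  for \<open>s = \<infinity>\<close> the factor is 1.\<close>

definition flatvec :: "ereal \<Rightarrow> (nat \<Rightarrow> real) \<Rightarrow> nat \<Rightarrow> real" where
  "flatvec s e i = real (card {i. e i \<noteq> 0}) powr (- rexp s) * e i"

lemma finite_signvecs: "finite (signvecs K r)"
proof (rule finite_subset)
  show "signvecs K r \<subseteq> {f. \<forall>x. (x \<in> {1..K} \<longrightarrow> f x \<in> {-1, 0, 1}) \<and> (x \<notin> {1..K} \<longrightarrow> f x = 0)}"
    by (auto simp: signvecs_def)
qed (intro finite_set_of_finite_funs; simp)

lemma signvecs_norming:
  assumes S: "S \<subseteq> {1..K}" "S \<noteq> {}" "card S \<le> r"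
  obtains e where "e \<in> signvecs K r"
    "(\<Sum>i\<in>S. \<bar>v i\<bar>) = (\<Sum>i=1..K. flatvec s e i * v i) * real (card S) powr rexp s"
proof
  \<comment> \<open>Unlike \<open>sgn\<close>, this takes the value 1 where \<open>v\<close>
    vanishes, so the support is all of \<open>S\<close> and the normalisation involves
    \<open>card S\<close>.\<close>
  define e :: "nat \<Rightarrow> real" where "e i = (if i \<in> S then if 0 \<le> v i then 1 else -1 else 0)" for i
  have supp: "{i. e i \<noteq> 0} = S"
    by (auto simp: e_def)
  have "finite S"
    using S finite_subset by blast
  then have card: "1 \<le> card S"
    using S by (simp add: Suc_le_eq card_gt_0_iff)
  show "e \<in> signvecs K r"
    unfolding signvecs_def mem_Collect_eq supp using S card by (auto simp: e_def)
  have "(\<Sum>i=1..K. flatvec s e i * v i) = (\<Sum>i=1..K. e i * v i) * real (card S) powr (- rexp s)"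
    by (simp add: flatvec_def supp sum_distrib_left mult_ac)
  moreover have "(\<Sum>i=1..K. e i * v i) = (\<Sum>i\<in>S. e i * v i)"
    using S by (intro sum.mono_neutral_right) (auto simp: e_def)
  moreover have "\<dots> = (\<Sum>i\<in>S. \<bar>v i\<bar>)"
    by (intro sum.cong) (auto simp: e_def)
  ultimately show "(\<Sum>i\<in>S. \<bar>v i\<bar>) = (\<Sum>i=1..K. flatvec s e i * v i) * real (card S) powr rexp s"
    using card by (simp add: mult.assoc flip: powr_add)
qed

lemma signvecs_nonempty: "1 \<le> K \<Longrightarrow> 1 \<le> r \<Longrightarrow> signvecs K r \<noteq> {}"
  using signvecs_norming[of "{1}" K r] by fastforce

lemma lnorm_flat_le_1:
  assumes "1 \<le> s" and e: "e \<in> signvecs K r" and J: "finite J" "{i. e i \<noteq> 0} \<subseteq> J"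
  shows "lnorm s J (flatvec s e) \<le> 1"
proof -
  define l where "l = card {i. e i \<noteq> 0}"
  have l: "1 \<le> l"
    using e by (simp add: signvecs_def l_def)
  have e01: "e i \<in> {-1, 0, 1}" for i
    using e by (auto simp: signvecs_def)
  have Jne: "J \<noteq> {}"
    using l J by (auto simp: l_def)
  show ?thesis
  proof (cases s)
    case PInf
    have "\<bar>flatvec s e i\<bar> \<le> 1" for i
      using PInf e01[of i] l by (auto simp: flatvec_def rexp_def l_def)
    then show ?thesis
      using PInf J Jne by (simp add: lnorm_infinity)
  next
    case (real t)
    have t: "1 \<le> t"
      using real assms(1) by (simp add: one_ereal_def)
    have "\<bar>flatvec s e i\<bar> powr t = (if e i \<noteq> 0 then 1 / l else 0)" for i
      using e01[of i] t l real
      by (auto simp: flatvec_def rexp_def l_def[symmetric] abs_mult powr_mult powr_divide powr_powr powr_minus_divide)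
    then have "(\<Sum>i\<in>J. \<bar>flatvec s e i\<bar> powr t) = (\<Sum>i\<in>J. if e i \<noteq> 0 then 1 / l else 0)"
      by simp
    also have "\<dots> = (\<Sum>i\<in>{i. e i \<noteq> 0}. 1 / l)"
      using J by (intro sum.mono_neutral_cong_right) auto
    also have "\<dots> = 1"
      using l by (simp add: l_def)
    finally show ?thesis
      using t real by (simp add: lnorm_ereal_le_1_iff)
  qed (use assms in auto)
qed

section \<open>Coordinate sets of fixed size, and reduction to flat vectors\<close>

lemma finite_subs: "finite (subs K k)"
  by (rule finite_subset[of _ "Pow {1..K}"]) (auto simp: subs_def)

lemma subsD:
  assumes "S \<in> subs K k" "1 \<le> k"
  shows "finite S" "S \<noteq> {}" "S \<subseteq> {1..K}" "card S = k"
  using assms finite_subset[of S "{1..K}"] by (auto simp: subs_def)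

lemma subs_nonempty: "k \<le> K \<Longrightarrow> subs K k \<noteq> {}"
  using obtain_subset_with_card_n[of k "{1..K}"] by (auto simp: subs_def)

text \<open>The suprema of the theorem run over sets of full size, while a flat vector may have a
  smaller support, which has to be enlarged.\<close>

lemma signvecs_supp_subset_subs:
  assumes "e \<in> signvecs K r" "r \<le> K"
  obtains S where "S \<in> subs K r" "{i. e i \<noteq> 0} \<subseteq> S"
  using exists_subset_between[of "{i. e i \<noteq> 0}" r "{1..K}"] assms
  by (auto simp: signvecs_def subs_def)

text \<open>This supplies the bound \<open>D1\<close> of the dominating process. For the transposed
  matrix, with \<open>hconj q\<close> and \<open>hconj p\<close> in the roles of \<open>p\<close>
  and \<open>q\<close>, it supplies \<open>D2\<close>.\<close>

lemma flat_row_norm_le: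
  assumes pq: "1 \<le> p" "1 \<le> q" and mM: "1 \<le> m" "m \<le> M" and nN: "1 \<le> n" "n \<le> N"
    and e: "e \<in> signvecs N n" and f: "f \<in> signvecs M m"
  shows "(\<Sum>i=1..M. \<bar>flatvec (hconj q) f i\<bar> * L2_set (\<lambda>j. B i j * flatvec p e j) {1..N})
    \<le> sqrt (Sup {opnorm (\<lambda>i j. (B i j)\<^sup>2) (p / 2) (q / 2) I J | I J. I \<in> subs M m \<and> J \<in> subs N n})"
proof -
  obtain I where I: "I \<in> subs M m" "{i. f i \<noteq> 0} \<subseteq> I"
    using signvecs_supp_subset_subs[OF f mM(2)] .
  obtain J where J: "J \<in> subs N n" "{i. e i \<noteq> 0} \<subseteq> J"
    using signvecs_supp_subset_subs[OF e nN(2)] .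
  note I' = subsD[OF I(1) mM(1)] and J' = subsD[OF J(1) nN(1)]
  have L2: "L2_set (\<lambda>j. B i j * flatvec p e j) {1..N} = sqrt (\<Sum>j\<in>J. (B i j)\<^sup>2 * (flatvec p e j)\<^sup>2)" for i
    unfolding L2_set_def power_mult_distrib using J J'
    by (intro arg_cong[of _ _ sqrt] sum.mono_neutral_right) (auto simp: flatvec_def)
  have "(\<Sum>i=1..M. \<bar>flatvec (hconj q) f i\<bar> * L2_set (\<lambda>j. B i j * flatvec p e j) {1..N})
      = (\<Sum>i\<in>I. \<bar>flatvec (hconj q) f i\<bar> * sqrt (\<Sum>j\<in>J. (B i j)\<^sup>2 * (flatvec p e j)\<^sup>2))"
    unfolding L2 using I I' by (intro sum.mono_neutral_right) (auto simp: flatvec_def)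
  also have "\<dots> \<le> sqrt (opnorm (\<lambda>i j. (B i j)\<^sup>2) (p / 2) (q / 2) I J)"
    by (intro sum_abs_mult_row_norm_le pq I' J' lnorm_flat_le_1[OF _ e] lnorm_flat_le_1[OF _ f]
        hconj_ge_1 I J)
  also have "\<dots> \<le> sqrt (Sup {opnorm (\<lambda>i j. (B i j)\<^sup>2) (p / 2) (q / 2) I J | I J.
      I \<in> subs M m \<and> J \<in> subs N n})"
  proof (intro real_sqrt_le_mono cSup_upper)
    have "{opnorm (\<lambda>i j. (B i j)\<^sup>2) (p / 2) (q / 2) I J | I J. I \<in> subs M m \<and> J \<in> subs N n}
        = (\<lambda>(I, J). opnorm (\<lambda>i j. (B i j)\<^sup>2) (p / 2) (q / 2) I J) ` (subs M m \<times> subs N n)"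
      by auto
    then show "bdd_above {opnorm (\<lambda>i j. (B i j)\<^sup>2) (p / 2) (q / 2) I J | I J.
        I \<in> subs M m \<and> J \<in> subs N n}"
      by (simp add: finite_subs)
  qed (use I J in blast)
  finally show ?thesis .
qed

text \<open>The two sides are flattened one after the other. In \<open>col\<close>, \<open>f\<close>
  is flat and \<open>x\<close> ranges over the whole ball, at the cost of the logarithm in
  \<open>n\<close>; then the image of a fixed \<open>x\<close> is tested against flat
  \<open>f\<close>, at the cost of the logarithm in \<open>m\<close>.\<close>

lemma opnorm_le_Max_flat:
  assumes pq: "1 \<le> p" "1 \<le> q" and mn: "1 \<le> m" "1 \<le> n"
    and I: "I \<in> subs M m" and J: "J \<in> subs N n"
  shows "opnorm B p q I J \<le> ln (exp 1 * real n) powr rexp (hconj p) * ln (exp 1 * real m) powr rexp q *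
    Max ((\<lambda>(e, f). \<Sum>i=1..M. \<Sum>j=1..N. B i j * flatvec (hconj q) f i * flatvec p e j)
      ` (signvecs N n \<times> signvecs M m))" (is "_ \<le> ?Ln * ?Lm * ?W")
proof -
  note I' = subsD[OF I mn(1)] and J' = subsD[OF J mn(2)]
  have W: "(\<Sum>i=1..M. \<Sum>j=1..N. B i j * flatvec (hconj q) f i * flatvec p e j) \<le> ?W"
    if "e \<in> signvecs N n" "f \<in> signvecs M m" for e f
    using that finite_signvecs by (intro Max_ge) auto
  have col: "(\<Sum>i=1..M. flatvec (hconj q) f i * (\<Sum>j\<in>J. B i j * x j)) \<le> ?Ln * ?W"
    if f: "f \<in> signvecs M m" and x: "lnorm p J x \<le> 1" for f x
  proof -
    define c where "c j = (\<Sum>i=1..M. B i j * flatvec (hconj q) f i)" for j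
    have "(\<Sum>i=1..M. flatvec (hconj q) f i * (\<Sum>j\<in>J. B i j * x j)) = (\<Sum>j\<in>J. x j * c j)"
      unfolding c_def sum_distrib_left by (subst sum.swap) (simp add: mult_ac)
    also have "\<dots> \<le> (\<Sum>j\<in>J. \<bar>x j\<bar> * \<bar>c j\<bar>)"
      by (intro sum_mono) (metis abs_ge_self abs_mult)
    also have "\<dots> \<le> lnorm (hconj p) J c"
      by (rule holder_lnorm[OF pq(1) J'(1,2) x])
    also have "\<dots> \<le> ln (exp 1 * real (card J)) powr rexp (hconj p) * ?W"
    proof (rule lnorm_le_if_partial_sums_le[OF pq(1) J'(1,2)])
      fix J0 assume J0: "J0 \<subseteq> J" "J0 \<noteq> {}"
      have "card J0 \<le> n"
        using card_mono[OF J'(1) J0(1)] J'(4) by simp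
      then obtain e where e: "e \<in> signvecs N n"
        "(\<Sum>j\<in>J0. \<bar>c j\<bar>) = (\<Sum>j=1..N. flatvec p e j * c j) * real (card J0) powr rexp p"
        using signvecs_norming[of J0 N n c p] J0 J'(3) by blast
      have "(\<Sum>j=1..N. flatvec p e j * c j)
          = (\<Sum>i=1..M. \<Sum>j=1..N. B i j * flatvec (hconj q) f i * flatvec p e j)"
        unfolding c_def sum_distrib_left by (subst sum.swap) (simp add: mult_ac)
      then show "(\<Sum>j\<in>J0. \<bar>c j\<bar>) \<le> ?W * real (card J0) powr rexp p"
        unfolding e(2) using W[OF e(1) f] by (intro mult_right_mono) auto
    qed
    finally show ?thesis
      by (simp add: J'(4))
  qed
  have "lnorm q I (\<lambda>i. \<Sum>j\<in>J. B i j * x j) \<le> ?Ln * ?Lm * ?W" if x: "lnorm p J x \<le> 1" for x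
  proof -
    \<comment> \<open>The lemma bounds the norm conjugate to that of its test vectors; these are
      flat for \<open>hconj q\<close>, so \<open>q\<close> is written as a double conjugate.\<close>
    have "lnorm (hconj (hconj q)) I (\<lambda>i. \<Sum>j\<in>J. B i j * x j)
        \<le> ln (exp 1 * real (card I)) powr rexp (hconj (hconj q)) * (?Ln * ?W)"
    proof (rule lnorm_le_if_partial_sums_le[OF hconj_ge_1[OF pq(2)] I'(1,2)])
      fix I0 assume I0: "I0 \<subseteq> I" "I0 \<noteq> {}"
      have "card I0 \<le> m"
        using card_mono[OF I'(1) I0(1)] I'(4) by simp
      then obtain f where f: "f \<in> signvecs M m"
        "(\<Sum>i\<in>I0. \<bar>\<Sum>j\<in>J. B i j * x j\<bar>)
          = (\<Sum>i=1..M. flatvec (hconj q) f i * (\<Sum>j\<in>J. B i j * x j)) * real (card I0) powr rexp (hconj q)"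
        using signvecs_norming[of I0 M m "\<lambda>i. \<Sum>j\<in>J. B i j * x j" "hconj q"] I0 I'(3) by blast
      show "(\<Sum>i\<in>I0. \<bar>\<Sum>j\<in>J. B i j * x j\<bar>) \<le> ?Ln * ?W * real (card I0) powr rexp (hconj q)"
        unfolding f(2) using col[OF f(1) x] by (intro mult_right_mono) auto
    qed
    then show ?thesis
      by (simp add: I'(4) hconj_hconj pq mult_ac)
  qed
  moreover have "lnorm p J (\<lambda>_. 0) \<le> 1"
    using J'(1,2) by (simp add: lnorm_def)
  ultimately show ?thesis
    unfolding opnorm_def by (intro cSup_least) auto
qed

section \<open>Transfer to the enlarged Gaussian vector, and conclusion\<close>

lemma gaussP_restrict:
  assumes "S \<subseteq> K" "finite K"
  shows "distr (gaussP K) (gaussP S) (\<lambda>g. restrict g S) = gaussP S"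
proof -
  interpret product_prob_space "\<lambda>_. gauss1" K
    by (rule product_prob_spaceI) (rule prob_space_gauss1)
  show ?thesis
    unfolding gaussP_def using assms by (intro distr_PiM_restrict_finite finite_subset[OF assms])
qed

lemma gauss_mat_eq_gaussP: "gauss_mat M N = gaussP ({1..M} \<times> {1..N})"
  by (simp add: gauss_mat_def gaussP_def gauss1_def)

lemma expectation_Max_flat_le:
  fixes A :: "nat \<Rightarrow> nat \<Rightarrow> real"
  assumes pq: "1 \<le> p" "1 \<le> q" and mM: "1 \<le> m" "m \<le> M" and nN: "1 \<le> n" "n \<le> N"
  shows "(\<integral>G. Max ((\<lambda>(e, f). \<Sum>i=1..M. \<Sum>j=1..N. (A i j * G (i, j)) * flatvec (hconj q) f i * flatvec p e j)
      ` (signvecs N n \<times> signvecs M m)) \<partial>gauss_mat M N)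
    \<le> (2.4 * sqrt (ln (real m * real n)) + 8 * sqrt (ln (real M)) + sqrt (2 / pi)) *
         sqrt (Sup {opnorm (\<lambda>i j. (A i j)\<^sup>2) (p / 2) (q / 2) I J | I J. I \<in> subs M m \<and> J \<in> subs N n})
      + (8 * sqrt (ln (real N)) + 2 * sqrt (2 / pi)) *
         sqrt (Sup {opnorm (\<lambda>j i. (A i j)\<^sup>2) (hconj q / 2) (hconj p / 2) J I | I J.
           I \<in> subs M m \<and> J \<in> subs N n})" (is "?E \<le> _ * ?D1 + _ * ?D2")
proof -
  let ?T = "signvecs N n \<times> signvecs M m" and ?P = "{1..M} \<times> {1..N}"
  \<comment> \<open>The class records both support sizes, rows first; it determines the moduli of
    both flat vectors.\<close>
  let ?\<kappa> = "\<lambda>(e :: nat \<Rightarrow> real, f :: nat \<Rightarrow> real). (card {i. f i \<noteq> 0}, card {j. e j \<noteq> 0})"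
  define K where "K = chevet_index M N m n"
  define X where "X g = Max ((\<lambda>t. \<Sum>i=1..M. \<Sum>j=1..N.
    A i j * flatvec (hconj q) (snd t) i * flatvec p (fst t) j * g (i, j)) ` ?T)" for g
  have T: "finite ?T" "?T \<noteq> {}"
    using finite_signvecs signvecs_nonempty mM nN by auto
  have PK: "?P \<subseteq> K" "finite K"
    unfolding K_def by (auto simp: chevet_index_def finite_chevet_index)
  have "?E = (\<integral>g. X g \<partial>gaussP ?P)"
    unfolding gauss_mat_eq_gaussP X_def by (simp add: case_prod_beta mult_ac)
  \<comment> \<open>\<open>X\<close> reads only matrix coordinates, so its expectation can be taken
    over the larger vector that also carries the auxiliary Gaussians.\<close>
  also have "\<dots> = (\<integral>g. X (restrict g ?P) \<partial>gaussP K)"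
  proof -
    have "(\<lambda>g. restrict g ?P) \<in> measurable (gaussP K) (gaussP ?P)"
      unfolding gaussP_def using PK(1) by (rule measurable_restrict_subset)
    moreover have "X \<in> borel_measurable (gaussP ?P)"
      unfolding X_def using T by measurable
    ultimately show ?thesis
      using integral_distr[of "\<lambda>g. restrict g ?P" "gaussP K" "gaussP ?P" X]
      unfolding gaussP_restrict[OF PK] by simp
  qed
  also have "\<dots> = (\<integral>g. X g \<partial>gaussP K)"
    unfolding X_def by (intro Bochner_Integration.integral_cong refl arg_cong[of _ _ Max] image_cong sum.cong) auto
  also have "\<dots> \<le> (2.4 * sqrt (ln (real m * real n)) + 8 * sqrt (ln (real M)) + sqrt (2 / pi)) * ?D1
      + (8 * sqrt (ln (real N)) + 2 * sqrt (2 / pi)) * ?D2"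
    unfolding X_def K_def
  proof (rule expectation_Max_bilinear_le[where \<kappa> = ?\<kappa> and c = "\<lambda>\<kappa>. real (snd \<kappa>) powr (- rexp p)"
        and d = "\<lambda>\<kappa>. real (fst \<kappa>) powr (- rexp (hconj q))"])
    fix t assume t: "t \<in> ?T"
    then have e: "fst t \<in> signvecs N n" and f: "snd t \<in> signvecs M m"
      by auto
    show "?\<kappa> t \<in> {1..m} \<times> {1..n}"
      using e f by (auto simp: signvecs_def case_prod_beta)
    have e01: "fst t j \<in> {-1, 0, 1}" and f01: "snd t j \<in> {-1, 0, 1}" for j
      using e f by (auto simp: signvecs_def)
    show "\<bar>flatvec p (fst t) j\<bar> \<in> {0, real (snd (?\<kappa> t)) powr (- rexp p)}" for j
      using e01[of j] by (auto simp: flatvec_def case_prod_beta abs_mult)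
    show "\<bar>flatvec (hconj q) (snd t) i\<bar> \<in> {0, real (fst (?\<kappa> t)) powr (- rexp (hconj q))}" for i
      using f01[of i] by (auto simp: flatvec_def case_prod_beta abs_mult)
    show "(\<Sum>i=1..M. \<bar>flatvec (hconj q) (snd t) i\<bar> * L2_set (\<lambda>j. A i j * flatvec p (fst t) j) {1..N}) \<le> ?D1"
      by (rule flat_row_norm_le[OF pq mM nN e f])
    have "{opnorm (\<lambda>j i. (A i j)\<^sup>2) (hconj q / 2) (hconj p / 2) J I | I J. I \<in> subs M m \<and> J \<in> subs N n}
        = {opnorm (\<lambda>j i. (A i j)\<^sup>2) (hconj q / 2) (hconj p / 2) J I | J I. J \<in> subs N n \<and> I \<in> subs M m}"
      by auto
    then show "(\<Sum>j=1..N. \<bar>flatvec p (fst t) j\<bar> * L2_set (\<lambda>i. A i j * flatvec (hconj q) (snd t) i) {1..M}) \<le> ?D2"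
      using flat_row_norm_le[OF hconj_ge_1[OF pq(2)] hconj_ge_1[OF pq(1)] nN mM f,
          of "fst t" "\<lambda>j i. A i j"] e by (simp add: hconj_hconj pq)
  qed (use T mM nN in auto)
  finally show ?thesis .
qed

theorem theorem1p5:
  fixes m M n N :: nat and p q :: ereal and A :: "nat \<Rightarrow> nat \<Rightarrow> real"
  assumes "1 \<le> m" "m \<le> M" "1 \<le> n" "n \<le> N"
    and "1 \<le> p" and "1 \<le> q"
  shows
   "(\<integral>\<^sup>+ G. ennreal (Sup {opnorm (\<lambda>i j. A i j * G (i, j)) p q I J | I J. I \<in> subs M m \<and> J \<in> subs N n})
        \<partial>gauss_mat M N)
    = (\<integral>\<^sup>+ G. ennreal (Sup {Sup {\<Sum>i\<in>I. \<Sum>j\<in>J. y i * A i j * G (i, j) * x j | x y.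
                     lnorm p J x \<le> 1 \<and> lnorm (hconj q) I y \<le> 1}
                 | I J. I \<in> subs M m \<and> J \<in> subs N n})
        \<partial>gauss_mat M N)
   \<and> (\<integral>\<^sup>+ G. ennreal (Sup {opnorm (\<lambda>i j. A i j * G (i, j)) p q I J | I J. I \<in> subs M m \<and> J \<in> subs N n})
        \<partial>gauss_mat M N)
     \<le> ennreal (ln (exp 1 * real n) powr rexp (hconj p) * ln (exp 1 * real m) powr rexp q *
        ((2.4 * sqrt (ln (real m * real n)) + 8 * sqrt (ln (real M)) + sqrt (2 / pi)) *
           sqrt (Sup {opnorm (\<lambda>i j. (A i j)\<^sup>2) (p / 2) (q / 2) I J | I J. I \<in> subs M m \<and> J \<in> subs N n})
         + (8 * sqrt (ln (real N)) + 2 * sqrt (2 / pi)) *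
           sqrt (Sup {opnorm (\<lambda>j i. (A i j)\<^sup>2) (hconj q / 2) (hconj p / 2) J I | I J. I \<in> subs M m \<and> J \<in> subs N n})))"
    (is "(\<integral>\<^sup>+ G. ennreal (?L G) \<partial>_) = (\<integral>\<^sup>+ G. ennreal (?R G) \<partial>_) \<and> _ \<le> ennreal (?Ln * ?Lm * ?D)")
proof
  have "opnorm (\<lambda>i j. A i j * G (i, j)) p q I J
      = Sup {\<Sum>i\<in>I. \<Sum>j\<in>J. y i * A i j * G (i, j) * x j | x y.
          lnorm p J x \<le> 1 \<and> lnorm (hconj q) I y \<le> 1}"
    if "I \<in> subs M m" for G I J
    using opnorm_eq_Sup_bilinear[OF \<open>1 \<le> q\<close> subsD(1,2)[OF that \<open>1 \<le> m\<close>],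
        of "\<lambda>i j. A i j * G (i, j)" p J]
    by (simp only: mult.assoc)
  then have "?L G = ?R G" for G
    by (intro arg_cong[of _ _ Sup] Collect_cong ex_cong1) auto
  then show "(\<integral>\<^sup>+ G. ennreal (?L G) \<partial>gauss_mat M N) = (\<integral>\<^sup>+ G. ennreal (?R G) \<partial>gauss_mat M N)"
    by simp
next
  let ?T = "signvecs N n \<times> signvecs M m"
  define W where "W G = Max ((\<lambda>(e, f). \<Sum>i=1..M. \<Sum>j=1..N.
    (A i j * G (i, j)) * flatvec (hconj q) f i * flatvec p e j) ` ?T)" for G
  have T: "finite ?T" "?T \<noteq> {}"
    using finite_signvecs signvecs_nonempty assms by auto
  have iW: "integrable (gauss_mat M N) W"
  proof -
    have "integrable (gauss_mat M N)
        (\<lambda>G. case t of (e, f) \<Rightarrow> \<Sum>i=1..M. \<Sum>j=1..N. (A i j * G (i, j)) * flatvec (hconj q) f i * flatvec p e j)" for t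
      unfolding gauss_mat_eq_gaussP case_prod_beta
      by (intro Bochner_Integration.integrable_sum integrable_mult_left integrable_mult_right
          integrable_gaussP_component) auto
    then show ?thesis
      unfolding W_def by (intro integrable_Max T)
  qed
  have le: "?L G \<le> ?Ln * ?Lm * W G" for G
  proof (rule cSup_least)
    show "{opnorm (\<lambda>i j. A i j * G (i, j)) p q I J | I J. I \<in> subs M m \<and> J \<in> subs N n} \<noteq> {}"
      using subs_nonempty[OF assms(2)] subs_nonempty[OF assms(4)] by blast
    fix a assume "a \<in> {opnorm (\<lambda>i j. A i j * G (i, j)) p q I J | I J. I \<in> subs M m \<and> J \<in> subs N n}"
    then obtain I J where "I \<in> subs M m" "J \<in> subs N n" "a = opnorm (\<lambda>i j. A i j * G (i, j)) p q I J"
      by blast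
    then show "a \<le> ?Ln * ?Lm * W G"
      unfolding W_def
      using opnorm_le_Max_flat[OF assms(5,6,1,3), of I M J N "\<lambda>i j. A i j * G (i, j)"] by simp
  qed
  \<comment> \<open>Sign vectors are closed under negation, so the maximum runs over a value
    together with its negative. Nonnegativity lets the nonnegative integral of \<open>W\<close>
    become an ordinary expectation.\<close>
  have W_nn: "0 \<le> W G" for G
  proof -
    obtain e f where ef: "e \<in> signvecs N n" "f \<in> signvecs M m"
      using T(2) by auto
    then have neg: "(\<lambda>j. - e j) \<in> signvecs N n"
      by (auto simp: signvecs_def image_subset_iff)
    let ?S = "\<lambda>e. \<Sum>i=1..M. \<Sum>j=1..N. (A i j * G (i, j)) * flatvec (hconj q) f i * flatvec p e j"
    have "?S e \<le> W G" "?S (\<lambda>j. - e j) \<le> W G"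
      unfolding W_def using T ef neg by (auto intro!: Max_ge)
    moreover have "?S (\<lambda>j. - e j) = - ?S e"
      by (simp add: flatvec_def sum_negf)
    ultimately show ?thesis by linarith
  qed
  \<comment> \<open>The nonnegative integral is monotone for arbitrary functions, so questions of
    measurability concern only the finite maximum \<open>W\<close>, not the supremum
    \<open>?L\<close> over uncountable balls.\<close>
  have "(\<integral>\<^sup>+ G. ennreal (?L G) \<partial>gauss_mat M N) \<le> (\<integral>\<^sup>+ G. ennreal (?Ln * ?Lm * W G) \<partial>gauss_mat M N)"
    by (intro nn_integral_mono ennreal_leI le)
  also have "\<dots> = ennreal (\<integral>G. ?Ln * ?Lm * W G \<partial>gauss_mat M N)"
    using iW W_nn by (intro nn_integral_eq_integral integrable_mult_right) auto
  also have "\<dots> = ennreal (?Ln * ?Lm * (\<integral>G. W G \<partial>gauss_mat M N))"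
    by simp
  also have "\<dots> \<le> ennreal (?Ln * ?Lm * ?D)"
    unfolding W_def using assms
    by (intro ennreal_leI mult_left_mono expectation_Max_flat_le) auto
  finally show "(\<integral>\<^sup>+ G. ennreal (?L G) \<partial>gauss_mat M N) \<le> ennreal (?Ln * ?Lm * ?D)" .
qed

end
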